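(* Let $\rho\in[0,1/3]$ be rational. Then $a(\rho)\le a_0(\rho)$, where $$ a_0(\rho)= \begin{cases} \mathsf{Krein}(\rho), & \rho\in [0,\rho_0]\\ \widehat{\mathsf{Krein}}(\rho), & \rho\in [\rho_0,\rho_1]\\ \frac{1-3\rho}{2}, & \rho \in [\rho_1, \rho_2]\\ \mathsf{Improved}(\rho), & \rho\in [\rho_2,9/32]\\ \rho/3, & \rho\in [9/32,3/10]\\ 2\rho-\frac 12, & \rho\in [3/10, 5/16]\\ \frac 25\rho, & \rho\in [5/16,1/3]. \end{cases} $$
   Context: All graphs are finite, simple and triangle-free. For a graph $G$ with $n$ vertices, its edge density is $\rho(G)=\frac{2|E(G)|}{n^2}$ (normalized by $n^2/2$). $G$ is $\rho$-regular if it is regular and $\rho(G)=\rho$, i.e. every vertex has exactly $\rho n$ neighbours. Let $N_G(v)$ be the neighbourhood of $v$ and $$a(G)=\min_{(u,v)\notin E(G)}\frac{|N_G(u)\cap N_G(v)|}{n},$$ the minimum being over all pairs of vertices not forming an edge. For rational $\rho\in[0,1/2]$, $$a(\rho)=\max\{a(G): G \text{ is a triangle-free } \rho\text{-regular graph}\}$$ (the maximum is attained; it may equivalently be read as a supremum). Functions and constants in the bound: $\bullet$ $f_K(\rho,a)=a^3+(3\rho-4)a^2+(5\rho-1)a-4\rho^3+\rho^2$, and $\mathsf{Krein}(\rho)$ is the largest (in fact the only) root $z$ of $f_K(\rho,z)=0$ in the interval $z\in\left[\rho^2,\frac{\rho^2}{1-\rho}\right]$. $\bullet$ $g_K(\rho,a)=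 a^4+a^3\big((4\sqrt 2-8)\rho +7-4\sqrt 2\big) + a^2\rho\big((6-4\sqrt 2)\rho +8\sqrt 2 -13\big) +a\rho\big(\rho^2 +(15-10\sqrt 2)\rho+2\sqrt 2-3\big)+\rho^3\big((8\sqrt 2-12)\rho+3-2\sqrt 2\big)$, and $\widehat{\mathsf{Krein}}(\rho)$ is the largest (in fact unique) root $z$ of $g_K(\rho,z)=0$ in the interval $z\in\left[\rho^2,\frac{\rho^2}{1-\rho}\right]$. $\bullet$ $\mathsf{Improved}(\rho)=\dfrac{15-22\rho-2\sqrt{242\rho-27-508\rho^2}}{74}$. $\bullet$ $\rho_0=\frac{3}{98}(10-\sqrt2)\approx 0.263$. $\bullet$ $\rho_1\approx 0.271$ is the root of the equation $g_K\left(\rho,\frac{1-3\rho}{2}\right)=0$ lying in the interval $[0.27,0.272]$. $\bullet$ $\rho_2=\frac{66+2\sqrt{13}}{269}\approx 0.272$, which is a root of $\mathsf{Improved}(\rho)=\frac{1-3\rho}{2}$. *)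

theory Defs
  imports "HOL-Analysis.Analysis" "Graph_Theory.Pair_Digraph"
begin

text \<open>
  A finite simple graph is a \<^locale>\<open>pair_graph\<close>: a finite vertex set \<^const>\<open>pverts\<close> together with
  a symmetric irreflexive relation \<^const>\<open>parcs\<close> on it.  An edge \<open>uv\<close> occurs in \<^const>\<open>parcs\<close> as the
  two pairs \<open>(u, v)\<close> and \<open>(v, u)\<close>; \<open>graph_edges\<close> counts it once.
\<close>

definition graph_edges :: "'a pair_pre_digraph \<Rightarrow> 'a set set" where
  "graph_edges G = {{u, v} | u v. (u, v) \<in> parcs G}"

definition nbhd :: "'a pair_pre_digraph \<Rightarrow> 'a \<Rightarrow> 'a set" where
  "nbhd G v = {w. (v, w) \<in> parcs G}"

definition triangle_free :: "'a pair_pre_digraph \<Rightarrow> bool" where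
  "triangle_free G \<longleftrightarrow>
     \<not> (\<exists>u v w. (u, v) \<in> parcs G \<and> (v, w) \<in> parcs G \<and> (u, w) \<in> parcs G)"

definition edge_density :: "'a pair_pre_digraph \<Rightarrow> real" where
  "edge_density G = 2 * real (card (graph_edges G)) / (real (card (pverts G)))\<^sup>2"

definition regular_graph :: "'a pair_pre_digraph \<Rightarrow> bool" where
  "regular_graph G \<longleftrightarrow> (\<exists>d. \<forall>v\<in>pverts G. card (nbhd G v) = d)"

text \<open>The empty graph is excluded, since its density is undefined.\<close>

definition rho_regular :: "real \<Rightarrow> 'a pair_pre_digraph \<Rightarrow> bool" where
  "rho_regular \<rho> G \<longleftrightarrow>
     pair_graph G \<and> pverts G \<noteq> {} \<and> regular_graph G \<and> edge_density G = \<rho>"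

text \<open>
  The pairs \<open>(u, u)\<close> are not edges and hence take part in the minimum.  In a regular graph they
  contribute its largest possible term, so they only matter for complete graphs, where there are
  no other pairs.
\<close>

definition min_codegree :: "'a pair_pre_digraph \<Rightarrow> real" where
  "min_codegree G =
     Min {real (card (nbhd G u \<inter> nbhd G v)) / real (card (pverts G)) | u v.
            u \<in> pverts G \<and> v \<in> pverts G \<and> (u, v) \<notin> parcs G}"

text \<open>
  Every finite graph is isomorphic to one whose vertices are natural numbers.  For rational
  \<open>\<rho> \<in> [0, 1/2]\<close> the set below is nonempty, and it is bounded above by \<open>\<rho>\<close>.
\<close>

definition a_max :: "real \<Rightarrow> real" where
  "a_max \<rho> = Sup {min_codegree G | G :: nat pair_pre_digraph. triangle_free G \<and> rho_regular \<rho> G}"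

definition f_K :: "real \<Rightarrow> real \<Rightarrow> real" where
  "f_K \<rho> a = a^3 + (3*\<rho> - 4) * a^2 + (5*\<rho> - 1) * a - 4*\<rho>^3 + \<rho>^2"

definition g_K :: "real \<Rightarrow> real \<Rightarrow> real" where
  "g_K \<rho> a =
     a^4
     + a^3 * ((4 * sqrt 2 - 8) * \<rho> + 7 - 4 * sqrt 2)
     + a^2 * \<rho> * ((6 - 4 * sqrt 2) * \<rho> + 8 * sqrt 2 - 13)
     + a * \<rho> * (\<rho>^2 + (15 - 10 * sqrt 2) * \<rho> + 2 * sqrt 2 - 3)
     + \<rho>^3 * ((8 * sqrt 2 - 12) * \<rho> + 3 - 2 * sqrt 2)"

definition Krein :: "real \<Rightarrow> real" where
  "Krein \<rho> = Max {z \<in> {\<rho>^2 .. \<rho>^2 / (1 - \<rho>)}. f_K \<rho> z = 0}"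

definition Krein_hat :: "real \<Rightarrow> real" where
  "Krein_hat \<rho> = Max {z \<in> {\<rho>^2 .. \<rho>^2 / (1 - \<rho>)}. g_K \<rho> z = 0}"

definition Improved :: "real \<Rightarrow> real" where
  "Improved \<rho> = (15 - 22*\<rho> - 2 * sqrt (242*\<rho> - 27 - 508*\<rho>^2)) / 74"

definition rho0 :: real where
  "rho0 = 3/98 * (10 - sqrt 2)"

definition rho1 :: real where
  "rho1 = (THE \<rho>. \<rho> \<in> {0.27 .. 0.272} \<and> g_K \<rho> ((1 - 3*\<rho>) / 2) = 0)"

definition rho2 :: real where
  "rho2 = (66 + 2 * sqrt 13) / 269"

text \<open>Neighbouring branches agree at the common endpoint of their intervals.\<close>

definition a0 :: "real \<Rightarrow> real" where
  "a0 \<rho> =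
     (if \<rho> \<le> rho0 then Krein \<rho>
      else if \<rho> \<le> rho1 then Krein_hat \<rho>
      else if \<rho> \<le> rho2 then (1 - 3*\<rho>) / 2
      else if \<rho> \<le> 9/32 then Improved \<rho>
      else if \<rho> \<le> 3/10 then \<rho> / 3
      else if \<rho> \<le> 5/16 then 2*\<rho> - 1/2
      else 2/5 * \<rho>)"

end

theory Submission
  imports Defs
begin

text \<open>
  Let a triangle-free graph have \<open>n\<close> vertices, degree \<open>d = \<rho> n\<close> and least codegree \<open>c = a n\<close>.  The bound
  \<open>a \<le> 2 \<rho> / 5\<close> comes from a pentagon (\<open>codegree_le_two_fifths\<close>).  All other bounds come from one
  pair of non-adjacent vertices \<open>u, v\<close> with codegree exactly \<open>c\<close>.  Let \<open>I\<close> be the set of their \<open>c\<close>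
  common neighbours and \<open>X\<close> the set of vertices adjacent to neither.  All neighbours of a vertex of
  \<open>I\<close> lie in \<open>X\<close>, and everything is about the traces \<open>N w \<inter> I\<close> of the vertices \<open>w \<in> X\<close>.

  \<^emph>\<open>The Krein bounds.\<close>  The trace sizes \<open>t w\<close> add up to \<open>c d\<close>, and the sum of their squares is the sum
  of all codegrees inside \<open>I\<close>.  Since \<open>I\<close> is contained in both \<open>N u\<close> and \<open>N v\<close>, these codegrees are
  controlled by how much the codegrees of \<open>w\<close> with \<open>u\<close> and \<open>v\<close> exceed \<open>c\<close> (\<open>sum_t_square_le\<close>).  A
  vertex with a large surplus in this sense has a large trace (\<open>surplus_le\<close>), and so it adds to the
  variance of \<open>t\<close>.  The resulting inequality \<open>trace_variance_bound\<close> has two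
  free parameters.  One choice of them gives \<open>f_K \<rho> a \<ge> 0\<close>, another one \<open>g_K \<rho> a \<ge> 0\<close>, and the sign
  of these polynomials at the trivial bound \<open>a \<le> \<rho>\<^sup>2 / (1 - \<rho>)\<close> places \<open>a\<close> below a root.

  \<^emph>\<open>The middle range.\<close>  Suppose \<open>a > \<rho> / 3\<close> and \<open>2 a + 3 \<rho> > 1\<close>.  By the first inequality a
  neighbourhood has no room for three disjoint sets of size \<open>c\<close>, hence any three pairwise
  non-adjacent vertices have a common neighbour.  By the second one the sets \<open>X - N x\<close>
  with \<open>x \<in> I\<close> have no room for three such sets either.  This makes the family of traces rigid (\<open>sunflower\<close>,
  \<open>difference_inseparable\<close>), and two cases remain.  If adjacent vertices of \<open>X\<close> always have
  complementary traces, there are at most two complementary pairs of traces besides \<open>I\<close>, two vertices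
  of \<open>I\<close> meet all of them, and together with \<open>u, v\<close> they form a dominating 4-cycle, so that
  \<open>n \<le> 4 d - 2 c\<close> (\<open>complementary_types_bound\<close>).  Otherwise \<open>I\<close> splits into three classes and every
  trace is a union of classes (\<open>separated_edge_classes\<close>); counting the vertices of each trace and
  their surplus gives a quadratic inequality (\<open>three_classes_quadratic\<close>) whose discriminant is the
  polynomial with the root \<open>Improved \<rho>\<close>.

  The lemma \<open>le_a0\<close> compares these results with the seven branches of \<open>a0\<close>.
\<close>

section \<open>Triangle-free regular graphs with codegree bounded below\<close>

lemma sum_card_Int_swap:
  fixes N :: "'a \<Rightarrow> 'a set"
  assumes fin: "finite S" "finite T"
    and sym: "\<And>p q. p \<in> N q \<longleftrightarrow> q \<in> N p"
  shows "(\<Sum>w\<in>S. card (N w \<inter> T)) = (\<Sum>x\<in>T. card (N x \<inter> S))"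
proof -
  have ind: "card (A \<inter> B) = (\<Sum>x\<in>B. if x \<in> A then 1 else 0)" if "finite B" for A B :: "'a set"
    using that by (simp add: Int_commute flip: sum.inter_restrict card_eq_sum)
  have "(\<Sum>w\<in>S. card (N w \<inter> T)) = (\<Sum>w\<in>S. \<Sum>x\<in>T. if x \<in> N w then 1 else 0)"
    by (simp only: ind[OF fin(2)])
  also have "\<dots> = (\<Sum>x\<in>T. \<Sum>w\<in>S. if w \<in> N x then 1 else 0)"
    using sym by (subst sum.swap) simp
  also have "\<dots> = (\<Sum>x\<in>T. card (N x \<inter> S))"
    by (simp only: ind[OF fin(1)])
  finally show ?thesis .
qed

text \<open>
  Neighbourhoods are given by a function on the whole type.  Because \<open>N v \<subseteq> V\<close> and the relation is
  symmetric, \<open>N v\<close> is empty for \<open>v \<notin> V\<close>, so most facts need no membership side conditions.  The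
  assumption \<open>disjoint_adj\<close> is triangle-freeness, and it also excludes loops.
\<close>
locale codegree_graph =
  fixes V :: "'a set" and N :: "'a \<Rightarrow> 'a set" and d c :: nat
  assumes finite_V: "finite V"
    and N_subset: "N v \<subseteq> V"
    and sym: "w \<in> N v \<longleftrightarrow> v \<in> N w"
    and disjoint_adj: "w \<in> N v \<Longrightarrow> N v \<inter> N w = {}"
    and card_N: "v \<in> V \<Longrightarrow> card (N v) = d"
    and codegree_ge: "\<lbrakk>v \<in> V; w \<in> V; w \<notin> N v\<rbrakk> \<Longrightarrow> c \<le> card (N v \<inter> N w)"
begin

abbreviation n :: nat where "n \<equiv> card V"

abbreviation codeg :: "'a \<Rightarrow> 'a \<Rightarrow> nat" where
  "codeg v w \<equiv> card (N v \<inter> N w)"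

lemma finite_N [simp]: "finite (N v)"
  using N_subset finite_V finite_subset by blast

lemma finite_sub [simp]: "S \<subseteq> V \<Longrightarrow> finite S"
  using finite_V finite_subset by blast

lemma in_V: "w \<in> N v \<Longrightarrow> w \<in> V" "w \<in> N v \<Longrightarrow> v \<in> V"
  using N_subset sym by blast+

lemma codeg_adj: "w \<in> N v \<Longrightarrow> codeg v w = 0"
  by (simp add: disjoint_adj)

lemma sum_card_swap:
  "\<lbrakk>S \<subseteq> V; T \<subseteq> V\<rbrakk> \<Longrightarrow> (\<Sum>w\<in>S. card (N w \<inter> T)) = (\<Sum>x\<in>T. card (N x \<inter> S))"
  using sum_card_Int_swap[of S T N] sym by auto

text \<open>
  Each path \<open>v x w\<close> of length two is counted once at its end \<open>w\<close>; adjacent pairs contribute nothing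
  because there are no triangles.
\<close>
lemma sum_codeg:
  assumes "v \<in> V"
  shows "(\<Sum>w\<in>V - N v. codeg v w) = d * d"
proof -
  have "(\<Sum>w\<in>V. codeg v w) = (\<Sum>w\<in>V. card (N w \<inter> N v))"
    by (simp add: Int_commute)
  also have "\<dots> = (\<Sum>x\<in>N v. card (N x \<inter> V))"
    by (rule sum_card_swap) (use N_subset in auto)
  also have "\<dots> = (\<Sum>x\<in>N v. d)"
    using N_subset card_N in_V by (intro sum.cong) (auto simp: Int_absorb2)
  also have "\<dots> = d * d" using assms card_N by simp
  finally have *: "(\<Sum>w\<in>V. codeg v w) = d * d" .
  have "(\<Sum>w\<in>V. codeg v w) = (\<Sum>w\<in>V - N v. codeg v w)"
    by (rule sum.mono_neutral_right) (auto simp: finite_V codeg_adj)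
  then show ?thesis using * by simp
qed

lemma card_compl_N: "v \<in> V \<Longrightarrow> card (V - N v) = n - d"
  using card_Diff_subset[of "N v" V] N_subset card_N by simp

lemma d_le_n: "v \<in> V \<Longrightarrow> d \<le> n"
  using card_mono[OF finite_V N_subset[of v]] card_N by simp

lemma degree_square_ge: "V \<noteq> {} \<Longrightarrow> c * (n - d) \<le> d * d"
proof -
  assume "V \<noteq> {}"
  then obtain v where v: "v \<in> V" by blast
  have "(\<Sum>w\<in>V - N v. c) \<le> (\<Sum>w\<in>V - N v. codeg v w)"
    by (rule sum_mono) (use v codegree_ge in auto)
  then show ?thesis using v by (simp add: sum_codeg card_compl_N mult.commute)
qed

lemma indicator_sum:
  "S \<subseteq> V \<Longrightarrow> (\<Sum>q\<in>V. if q \<in> S then 1 else 0::int) = int (card S)"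
  by (simp add: finite_V flip: sum.inter_restrict of_nat_sum) (simp add: Int_absorb1)

text \<open>
  If the non-neighbours of \<open>v\<close> spanned no edge, the graph would be bipartite with parts \<open>N v\<close> and
  \<open>V - N v\<close>, and a regular bipartite graph has parts of equal size.  An edge \<open>w w'\<close> among the
  non-neighbours extends to a pentagon through common neighbours of \<open>v\<close> with \<open>w\<close> and with \<open>w'\<close>.
\<close>
lemma exists_pentagon:
  assumes "V \<noteq> {}" "0 < d" "n \<noteq> 2 * d" "0 < c"
  obtains v x w w' x' where "x \<in> N v" "w \<in> N x" "w' \<in> N w" "x' \<in> N w'" "v \<in> N x'"
proof -
  obtain v where v: "v \<in> V" using assms by blast
  have "\<exists>w\<in>V - N v. \<exists>w'\<in>V - N v. w' \<in> N w"
  proof (rule ccontr)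
    assume none: "\<not> ?thesis"
    have "(\<Sum>w\<in>V - N v. card (N w \<inter> N v)) = (\<Sum>w\<in>V - N v. d)"
    proof (intro sum.cong refl)
      fix w assume w: "w \<in> V - N v"
      then have "N w \<inter> N v = N w" using none N_subset by blast
      then show "card (N w \<inter> N v) = d" using w card_N by simp
    qed
    then have "(n - d) * d = d * d"
      using sum_codeg[OF v] v by (simp add: Int_commute card_compl_N)
    then show False using assms d_le_n[OF v] by auto
  qed
  then obtain w w' where w: "w \<in> V" "w \<notin> N v" "w' \<in> V" "w' \<notin> N v" "w' \<in> N w" by blast
  from w codegree_ge[of v w] codegree_ge[of v w'] v assms
  have "N v \<inter> N w \<noteq> {}" "N v \<inter> N w' \<noteq> {}" by auto
  then obtain x x' where "x \<in> N v" "x \<in> N w" "x' \<in> N v" "x' \<in> N w'" by blast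
  then show ?thesis using that[of x v w w' x'] w v sym by blast
qed

text \<open>
  If a vertex \<open>q\<close> had no neighbour on a pentagon, the five sets \<open>N q \<inter> N p\<^sub>i\<close> would have at least \<open>c\<close>
  elements each while consecutive ones are disjoint, so that every point of \<open>N q\<close> lies in at most
  two of them: \<open>5 c \<le> 2 d\<close>.  Otherwise every vertex is adjacent to one or two vertices of the
  pentagon, and inclusion--exclusion gives \<open>n \<le> 5 d - 5 c\<close>, which is less than \<open>3 d\<close>.
\<close>
lemma codegree_le_two_fifths:
  assumes "V \<noteq> {}" "3 * d \<le> n"
  shows "5 * c \<le> 2 * d"
proof (rule ccontr)
  assume "\<not> ?thesis"
  then have big: "2 * d < 5 * c" by simp
  obtain v0 where "v0 \<in> V" using assms by blast
  have "0 < n" using assms finite_V by (simp add: card_gt_0_iff)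
  have "0 < d"
  proof (rule ccontr)
    assume "\<not> 0 < d"
    then have "c * n \<le> 0" using degree_square_ge[OF assms(1)] by simp
    then show False using big \<open>0 < n\<close> by simp
  qed
  moreover from this have "n \<noteq> 2 * d" "0 < c" using assms big by auto
  ultimately obtain p1 p2 p3 p4 p5 where p: "p2 \<in> N p1" "p3 \<in> N p2" "p4 \<in> N p3" "p5 \<in> N p4" "p1 \<in> N p5"
    using exists_pentagon[OF assms(1)] by metis
  have pV: "p1 \<in> V" "p2 \<in> V" "p3 \<in> V" "p4 \<in> V" "p5 \<in> V" using p in_V by blast+
  have dis: "N p1 \<inter> N p2 = {}" "N p2 \<inter> N p3 = {}" "N p3 \<inter> N p4 = {}" "N p4 \<inter> N p5 = {}" "N p5 \<inter> N p1 = {}"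
    using p disjoint_adj by auto
  have non: "p3 \<notin> N p1" "p4 \<notin> N p2" "p5 \<notin> N p3" "p1 \<notin> N p4" "p2 \<notin> N p5"
    using p dis sym by blast+
  have meet: "q \<in> N p1 \<or> q \<in> N p2 \<or> q \<in> N p3 \<or> q \<in> N p4 \<or> q \<in> N p5" if q: "q \<in> V" for q
  proof (rule ccontr)
    assume no: "\<not> ?thesis"
    let ?f = "\<lambda>p z. if z \<in> N q \<inter> N p then 1 else 0::int"
    have "(\<Sum>z\<in>V. ?f p1 z + ?f p2 z + ?f p3 z + ?f p4 z + ?f p5 z) \<le> (\<Sum>z\<in>V. 2 * (if z \<in> N q then 1 else 0))"
      using dis by (intro sum_mono) auto
    moreover have "(\<Sum>z\<in>V. ?f p z) = int (codeg q p)" for p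
      by (rule indicator_sum) (use N_subset in blast)
    moreover have "(\<Sum>z\<in>V. if z \<in> N q then 1 else 0::int) = d"
      using indicator_sum[of "N q"] N_subset q card_N by simp
    ultimately have "int (codeg q p1) + codeg q p2 + codeg q p3 + codeg q p4 + codeg q p5 \<le> 2 * d"
      by (simp add: sum.distrib flip: sum_distrib_left)
    moreover have "c \<le> codeg q p1" "c \<le> codeg q p2" "c \<le> codeg q p3" "c \<le> codeg q p4" "c \<le> codeg q p5"
      using no pV q codegree_ge sym by blast+
    ultimately show False using big by linarith
  qed
  \<comment> \<open>Every vertex is met once or twice, and exactly one pair covers it in the second case.\<close>
  let ?g = "\<lambda>S z. if z \<in> S then 1 else 0::int"
  have "(\<Sum>q\<in>V. 1) \<le> (\<Sum>q\<in>V. (?g (N p1) q + ?g (N p2) q + ?g (N p3) q + ?g (N p4) q + ?g (N p5) q)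
      - (?g (N p1 \<inter> N p3) q + ?g (N p2 \<inter> N p4) q + ?g (N p3 \<inter> N p5) q + ?g (N p4 \<inter> N p1) q + ?g (N p5 \<inter> N p2) q))"
  proof (rule sum_mono)
    fix q assume "q \<in> V"
    then show "1 \<le> (?g (N p1) q + ?g (N p2) q + ?g (N p3) q + ?g (N p4) q + ?g (N p5) q)
      - (?g (N p1 \<inter> N p3) q + ?g (N p2 \<inter> N p4) q + ?g (N p3 \<inter> N p5) q + ?g (N p4 \<inter> N p1) q + ?g (N p5 \<inter> N p2) q)"
      using meet[of q] dis by auto
  qed
  moreover have "(\<Sum>q\<in>V. ?g (N p) q) = d" if "p \<in> V" for p
    using indicator_sum[of "N p"] N_subset that card_N by simp
  moreover have "(\<Sum>q\<in>V. ?g (N p \<inter> N p') q) = int (codeg p p')" for p p'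
    by (rule indicator_sum) (use N_subset in blast)
  ultimately have "int n \<le> 5 * d - (int (codeg p1 p3) + codeg p2 p4 + codeg p3 p5 + codeg p4 p1 + codeg p5 p2)"
    using pV by (simp add: sum.distrib sum_subtractf)
  moreover have "c \<le> codeg p1 p3" "c \<le> codeg p2 p4" "c \<le> codeg p3 p5" "c \<le> codeg p4 p1" "c \<le> codeg p5 p2"
    using non pV codegree_ge by blast+
  ultimately show False using big assms by linarith
qed

end

section \<open>Traces on the common neighbourhood of a tight pair\<close>

text \<open>
  A pair that attains the minimum codegree.  Having \<open>card I = c\<close> exactly, and not just at least \<open>c\<close>,
  is what makes the estimates below sharp.
\<close>
locale tight_pair = codegree_graph +
  fixes u v :: 'a
  assumes u_in: "u \<in> V" and v_in: "v \<in> V" and nonadj: "v \<notin> N u"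
    and tight: "card (N u \<inter> N v) = c"
begin

definition I :: "'a set" where "I = N u \<inter> N v"

definition X :: "'a set" where "X = V - (N u \<union> N v)"

abbreviation trace :: "'a \<Rightarrow> 'a set" where "trace w \<equiv> N w \<inter> I"

definition t :: "'a \<Rightarrow> real" where "t w = real (card (trace w))"

text \<open>
  By how much \<open>w\<close> exceeds the minimum codegree towards \<open>u\<close> and \<open>v\<close> together.  On \<open>X\<close> it is
  nonnegative, and it is large where \<open>w\<close> resembles \<open>u\<close> or \<open>v\<close>.
\<close>
definition surplus :: "'a \<Rightarrow> real" where
  "surplus w = real (codeg u w) + real (codeg v w) - 2 * real c"

text \<open>
  The sum of \<open>codeg q w - c\<close> over the non-neighbours \<open>w\<close> of any one vertex \<open>q\<close>; see
  \<open>sum_codeg_excess\<close>.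
\<close>
definition excess :: real where
  "excess = (real d)\<^sup>2 - real c * (real n - real d)"

lemma I_subset: "I \<subseteq> V" and X_subset: "X \<subseteq> V"
  using N_subset by (auto simp: I_def X_def)

lemma finite_I [simp]: "finite I" and finite_X [simp]: "finite X"
  using I_subset X_subset by auto

lemma card_I: "card I = c"
  by (simp add: I_def tight)

lemma V_nonempty: "V \<noteq> {}"
  using u_in by blast

lemma I_in_X: "x \<in> I \<Longrightarrow> N x \<subseteq> X"
  using disjoint_adj sym N_subset by (fastforce simp: I_def X_def)

lemma card_X: "real (card X) = real n - 2 * real d + real c"
proof -
  have "card (N u \<union> N v) + c = d + d"
    using card_Un_Int[of "N u" "N v"] tight card_N u_in v_in by simp
  moreover have "card X = n - card (N u \<union> N v)"
    unfolding X_def using N_subset by (intro card_Diff_subset) auto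
  moreover have "card (N u \<union> N v) \<le> n"
    using N_subset by (intro card_mono[OF finite_V]) auto
  ultimately show ?thesis by simp
qed

lemma surplus_nonneg: "w \<in> X \<Longrightarrow> 0 \<le> surplus w"
  using codegree_ge[of u w] codegree_ge[of v w] u_in v_in by (simp add: X_def surplus_def)

lemma t_le: "t w \<le> real c"
  using card_mono[OF finite_I, of "N w \<inter> I"] by (simp add: t_def card_I)

lemma sum_trace_weight:
  fixes f :: "'a \<Rightarrow> real"
  shows "(\<Sum>w\<in>X. t w * f w) = (\<Sum>x\<in>I. \<Sum>w\<in>N x. f w)"
proof -
  have "(\<Sum>w\<in>X. t w * f w) = (\<Sum>w\<in>X. \<Sum>x\<in>I. if x \<in> N w then f w else 0)"
    by (intro sum.cong refl)
      (simp add: t_def sum.inter_restrict[symmetric] Int_commute)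
  also have "\<dots> = (\<Sum>x\<in>I. \<Sum>w\<in>X. if w \<in> N x then f w else 0)"
    using sym by (subst sum.swap) simp
  also have "\<dots> = (\<Sum>x\<in>I. \<Sum>w\<in>N x. f w)"
  proof (rule sum.cong[OF refl])
    fix x assume "x \<in> I"
    then have "X \<inter> N x = N x" using I_in_X by blast
    then show "(\<Sum>w\<in>X. if w \<in> N x then f w else 0) = (\<Sum>w\<in>N x. f w)"
      using sum.inter_restrict[OF finite_X, of f "N x"] by simp
  qed
  finally show ?thesis .
qed

lemma sum_t: "(\<Sum>w\<in>X. t w) = real c * real d"
  using sum_trace_weight[of "\<lambda>_. 1"] I_subset card_N by (simp add: card_I subset_iff)

lemma sum_codeg_over_N: "(\<Sum>w\<in>N x. real (codeg y w)) = (\<Sum>z\<in>N y. real (codeg x z))"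
  using sum_card_swap[of "N x" "N y"] N_subset
  by (simp add: Int_commute flip: of_nat_sum)

text \<open>
  Sum \<open>codeg x y - c\<close> over \<open>y \<in> I\<close>, over \<open>y \<in> N u\<close> and over \<open>y \<in> N v\<close>; double counting turns the
  three sums into the three terms of the claim.  No such \<open>y\<close> is adjacent to \<open>x\<close>, so all summands are
  nonnegative, and the first sum is at most each of the other two because \<open>I\<close> is contained in both
  neighbourhoods.
\<close>
lemma neighbour_t_sum_le:
  assumes x: "x \<in> I"
  shows "(\<Sum>w\<in>N x. t w) \<le> (real c)\<^sup>2 + (\<Sum>w\<in>N x. surplus w) / 2"
proof -
  define ex where "ex y = real (codeg x y) - real c" for y
  have xV: "x \<in> V" and xu: "N u \<inter> N x = {}" and xv: "N v \<inter> N x = {}"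
    using x I_subset disjoint_adj by (auto simp: I_def)
  have ex0: "0 \<le> ex y" if "y \<in> N u \<union> N v" for y
    using that codegree_ge[of x y] xV xu xv N_subset by (auto simp: ex_def)
  have N: "(\<Sum>y\<in>N p. ex y) = (\<Sum>w\<in>N x. real (codeg p w)) - real c * real d" if "p \<in> V" for p
    using that sum_codeg_over_N[of p x] by (simp add: ex_def sum_subtractf card_N mult.commute)
  have I: "(\<Sum>y\<in>I. ex y) = (\<Sum>w\<in>N x. t w) - (real c)\<^sup>2"
    using sum_card_swap[of "N x" I] N_subset I_subset
    by (simp add: ex_def t_def sum_subtractf card_I power2_eq_square Int_commute flip: of_nat_sum)
  have "(\<Sum>y\<in>I. ex y) \<le> (\<Sum>y\<in>N p. ex y)" if "p = u \<or> p = v" for p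
    using that ex0 by (intro sum_mono2) (auto simp: I_def)
  from this[of u] this[of v] show ?thesis
    using N[OF u_in] N[OF v_in] I card_N[OF xV]
    by (simp add: surplus_def sum.distrib sum_subtractf field_simps)
qed

lemma sum_t_square_le:
  "(\<Sum>w\<in>X. (t w)\<^sup>2) - (\<Sum>w\<in>X. t w * surplus w) / 2 \<le> (real c)^3"
proof -
  have "(\<Sum>w\<in>X. (t w)\<^sup>2) = (\<Sum>x\<in>I. \<Sum>w\<in>N x. t w)"
    using sum_trace_weight[of t] by (simp add: power2_eq_square)
  also have "\<dots> \<le> (\<Sum>x\<in>I. (real c)\<^sup>2 + (\<Sum>w\<in>N x. surplus w) / 2)"
    by (intro sum_mono neighbour_t_sum_le)
  also have "\<dots> = (real c)^3 + (\<Sum>w\<in>X. t w * surplus w) / 2"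
    by (simp add: sum_trace_weight sum.distrib card_I power3_eq_cube power2_eq_square
        flip: sum_divide_distrib)
  finally show ?thesis by simp
qed

lemma sum_codeg_excess: 
  assumes "q \<in> V"
  shows "(\<Sum>w\<in>V - N q. real (codeg q w) - real c) = excess"
  using sum_codeg[OF assms] card_compl_N[OF assms] d_le_n[OF assms]
  by (simp add: excess_def sum_subtractf power2_eq_square of_nat_diff mult.commute
      flip: of_nat_sum of_nat_mult)

lemma sum_surplus_le: "(\<Sum>w\<in>X. surplus w) \<le> 2 * excess"
proof -
  have "(\<Sum>w\<in>X. real (codeg q w) - real c) \<le> excess" if "q = u \<or> q = v" for q
  proof -
    have q: "q \<in> V" using that u_in v_in by blast
    have "(\<Sum>w\<in>X. real (codeg q w) - real c) \<le> (\<Sum>w\<in>V - N q. real (codeg q w) - real c)"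
      using that q codegree_ge[of q] by (intro sum_mono2) (auto simp: finite_V X_def)
    then show ?thesis using q by (simp add: sum_codeg_excess)
  qed
  from this[of u] this[of v] show ?thesis
    by (simp add: surplus_def sum.distrib sum_subtractf)
qed

lemma excess_nonneg: "0 \<le> excess"
  using sum_codeg_excess[OF u_in, symmetric] codegree_ge[OF u_in] by (auto intro!: sum_nonneg)

lemma card_N_Int_X: 
  assumes "w \<in> X"
  shows "real (card (N w \<inter> X)) = real d - 2 * real c - surplus w + t w"
proof -
  have w: "w \<in> V" using assms X_subset by blast
  have "card (N w \<inter> N u \<union> N w \<inter> N v) + card (N w \<inter> I) = codeg w u + codeg w v"
    using card_Un_Int[of "N w \<inter> N u" "N w \<inter> N v"] by (simp add: I_def Int_ac)
  moreover have "N w = (N w \<inter> X) \<union> (N w \<inter> N u \<union> N w \<inter> N v)"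
    using N_subset by (auto simp: X_def)
  then have "card (N w) = card (N w \<inter> X) + card (N w \<inter> N u \<union> N w \<inter> N v)"
    by (metis (no_types, lifting) card_Un_disjoint finite_Int finite_N finite_UnI X_def
        Diff_disjoint Int_Un_distrib Int_assoc Int_commute Int_empty_right)
  ultimately have "d + codeg w u + codeg w v = card (N w \<inter> X) + codeg w u + codeg w v + codeg w u + codeg w v - card (trace w) "
    using card_N[OF w] by linarith
  then show ?thesis
    using card_N[OF w] \<open>card (N w) = _\<close> \<open>card (N w \<inter> N u \<union> N w \<inter> N v) + _ = _\<close>
    by (simp add: surplus_def t_def Int_commute)
qed

text \<open>
  If some \<open>x \<in> I\<close> is not adjacent to \<open>w\<close>, then \<open>w\<close> has at least \<open>c\<close> common neighbours with it, all
  of them in \<open>X\<close> and hence outside \<open>N u \<union> N v\<close>.  This leaves less room in \<open>N w\<close> for neighbours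
  shared with \<open>u\<close> or \<open>v\<close>.
\<close>
lemma surplus_le:
  assumes "w \<in> X"
  shows "surplus w \<le> real d - 3 * real c + 2 * t w"
proof (cases "I \<subseteq> N w")
  case True
  then have "t w = c" by (simp add: t_def Int_absorb1 card_I)
  then show ?thesis using card_N_Int_X[OF assms] by simp
next
  case False
  then obtain x where x: "x \<in> I" "x \<notin> N w" by blast
  have "c \<le> codeg w x"
    using codegree_ge x assms I_subset X_subset by blast
  also have "\<dots> \<le> card (N w \<inter> X)"
    using I_in_X[OF x(1)] by (intro card_mono) auto
  finally show ?thesis
    using card_N_Int_X[OF assms] t_le[of w] by (simp add: t_def)
qed

text \<open>
  The second moment of \<open>t\<close> about \<open>t0\<close> is bounded above by \<open>sum_t_square_le\<close>.  It is bounded below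
  because a vertex with surplus \<open>\<gamma>\<close> contributes at least \<open>(c - t0)\<^sup>2 / (d - c) * \<gamma>\<close> to
  \<open>(t w - t0)\<^sup>2 + (c - t w) * \<gamma> / 2\<close>, whatever \<open>t0\<close> is.  The condition \<open>k \<le> c / 2\<close> makes the
  coefficient of the total surplus nonnegative, so that \<open>sum_surplus_le\<close> applies.
\<close>
lemma trace_variance_bound:
  fixes t0 k :: real
  assumes "c < d" and k1: "k \<le> (real c - t0)\<^sup>2 / (real d - real c)" and k2: "k \<le> real c / 2"
  shows "2 * k * excess \<le>
    (real c)^3 + real c * excess - 2 * t0 * real c * real d + t0\<^sup>2 * (real n - 2 * real d + real c)"
proof -
  let ?R = "real d - real c"
  have R: "0 < ?R" using assms by simp
  have "k * surplus w \<le> (t w - t0)\<^sup>2 + (real c - t w) * surplus w / 2" if w: "w \<in> X" for w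
  proof -
    define h \<tau> \<gamma> where "h = real c - t0" and "\<tau> = real c - t w" and "\<gamma> = surplus w"
    have \<gamma>: "0 \<le> \<gamma>" "\<gamma> \<le> ?R - 2 * \<tau>" and \<tau>: "0 \<le> \<tau>"
      using surplus_nonneg[OF w] surplus_le[OF w] t_le[of w] by (auto simp: \<gamma>_def \<tau>_def)
    have ineq: "h\<^sup>2 * \<gamma> \<le> ?R * ((h - \<tau>)\<^sup>2 + \<tau> * \<gamma> / 2)"
    proof (cases "?R = \<gamma>")
      case True
      then have "\<tau> = 0" using \<gamma> \<tau> by linarith
      then show ?thesis using True by (simp add: algebra_simps)
    next
      case False
      then have D: "0 < ?R - \<gamma>" using \<gamma> \<tau> by linarith
      \<comment> \<open>As a quadratic in \<open>h\<close>, the claim has a discriminant of the sign of \<open>\<gamma> + 2 * \<tau> - ?R\<close>.\<close>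
      have "0 \<le> ((?R - \<gamma>) * h - \<tau> * ?R)\<^sup>2 + ?R * \<tau> * \<gamma> * (?R - 2 * \<tau> - \<gamma>) / 2"
        using R \<gamma> \<tau> by (intro add_nonneg_nonneg divide_nonneg_nonneg mult_nonneg_nonneg) auto
      also have "\<dots> = (?R - \<gamma>) * (?R * ((h - \<tau>)\<^sup>2 + \<tau> * \<gamma> / 2) - h\<^sup>2 * \<gamma>)"
        by (simp add: field_simps power2_eq_square)
      finally show ?thesis using D by (simp add: zero_le_mult_iff)
    qed
    have "k * \<gamma> \<le> h\<^sup>2 / ?R * \<gamma>"
      using k1 \<gamma> by (intro mult_right_mono) (auto simp: h_def)
    also have "\<dots> \<le> (h - \<tau>)\<^sup>2 + \<tau> * \<gamma> / 2"
      using ineq R by (simp add: field_simps)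
    finally show ?thesis by (simp add: h_def \<tau>_def \<gamma>_def)
  qed
  then have "(\<Sum>w\<in>X. k * surplus w) \<le> (\<Sum>w\<in>X. (t w - t0)\<^sup>2 + (real c - t w) * surplus w / 2)"
    by (rule sum_mono)
  also have "\<dots> = (\<Sum>w\<in>X. (t w)\<^sup>2) - 2 * t0 * (\<Sum>w\<in>X. t w) + t0\<^sup>2 * real (card X)
      + real c / 2 * (\<Sum>w\<in>X. surplus w) - (\<Sum>w\<in>X. t w * surplus w) / 2"
  proof -
    have "(t w - t0)\<^sup>2 + (real c - t w) * surplus w / 2 =
        (t w)\<^sup>2 - 2 * t0 * t w + t0\<^sup>2 + real c / 2 * surplus w - t w * surplus w / 2" for w
      by (simp add: power2_eq_square field_simps)
    then show ?thesis
      by (simp add: sum.distrib sum_subtractf sum_distrib_left sum_divide_distrib)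
  qed
  finally have "0 \<le> (real c)^3 - 2 * t0 * real c * real d + t0\<^sup>2 * real (card X)
      + (real c / 2 - k) * (\<Sum>w\<in>X. surplus w)"
    using sum_t_square_le by (simp add: sum_t algebra_simps flip: sum_distrib_left)
  also have "(real c / 2 - k) * (\<Sum>w\<in>X. surplus w) \<le> (real c / 2 - k) * (2 * excess)"
    using sum_surplus_le k2 by (intro mult_left_mono) auto
  finally show ?thesis by (simp add: card_X algebra_simps)
qed

end

section \<open>Traces when three disjoint codegree sets do not fit\<close>

lemma card_disjoint3_le:
  assumes "finite D" "A \<subseteq> D" "B \<subseteq> D" "C \<subseteq> D" "A \<inter> B = {}" "A \<inter> C = {}" "B \<inter> C = {}"
  shows "card A + card B + card C \<le> card D"
proof -
  have fin: "finite A" "finite B" "finite C" using assms by (auto intro: finite_subset[of _ D])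
  have "card A + card B + card C = card (A \<union> B \<union> C)"
    using assms fin by (simp add: card_Un_disjoint Int_Un_distrib2)
  also have "\<dots> \<le> card D" using assms by (intro card_mono) auto
  finally show ?thesis .
qed

context codegree_graph
begin

text \<open>
  Otherwise a common neighbour \<open>p\<close> of \<open>x\<close> and \<open>y\<close> is not adjacent to \<open>z\<close>, and the neighbours that \<open>z\<close>
  shares with \<open>x\<close>, with \<open>y\<close> and with \<open>p\<close> form three disjoint subsets of \<open>N z\<close> of size at least \<open>c\<close>.
\<close>
lemma independent_triple_common_neighbour:
  assumes "d < 3 * c" "x \<in> V" "y \<in> V" "z \<in> V" "y \<notin> N x" "z \<notin> N x" "z \<notin> N y"
  shows "N x \<inter> N y \<inter> N z \<noteq> {}"
proof
  assume none: "N x \<inter> N y \<inter> N z = {}"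
  have "0 < c" using assms by simp
  then have "N x \<inter> N y \<noteq> {}" using codegree_ge[of x y] assms by auto
  then obtain p where p: "p \<in> N x" "p \<in> N y" by blast
  then have pz: "z \<notin> N p" using none sym by blast
  have disj: "N z \<inter> N x \<inter> (N z \<inter> N y) = {}" "(N z \<inter> N x \<union> N z \<inter> N y) \<inter> (N z \<inter> N p) = {}"
    using none disjoint_adj p by blast+
  have "card (N z \<inter> N x) + card (N z \<inter> N y) + card (N z \<inter> N p)
      = card (N z \<inter> N x \<union> N z \<inter> N y \<union> N z \<inter> N p)"
    using disj by (simp add: card_Un_disjoint)
  also have "\<dots> \<le> card (N z)" by (intro card_mono) auto
  finally have "codeg z x + codeg z y + codeg z p \<le> d" using assms card_N by simp
  moreover have "c \<le> codeg z x" "c \<le> codeg z y" "c \<le> codeg z p"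
    using assms sym codegree_ge pz p in_V by blast+
  ultimately show False using assms by linarith
qed

end

text \<open>
  The first inequality says that no neighbourhood contains three disjoint sets of size \<open>c\<close>, the
  second one that no set \<open>X - N x\<close> with \<open>x \<in> I\<close> does.
\<close>
locale dense_tight_pair = tight_pair +
  assumes d_less: "d < 3 * c" and n_less: "n < 3 * d + 2 * c"
begin

definition types :: "'a set set" where "types = trace ` X"

definition cell :: "'a set \<Rightarrow> 'a set" where "cell P = {w \<in> X. trace w = P}"

lemma c_pos: "0 < c"
  using d_less by simp

lemma I_nonempty: "I \<noteq> {}"
  using c_pos card_I by auto

lemma I_independent: "\<lbrakk>x \<in> I; y \<in> I\<rbrakk> \<Longrightarrow> y \<notin> N x"
  using I_in_X by (auto simp: X_def I_def)

lemma type_subset: "P \<in> types \<Longrightarrow> P \<subseteq> I"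
  by (auto simp: types_def)

lemma type_nonempty: "P \<in> types \<Longrightarrow> P \<noteq> {}"
  using independent_triple_common_neighbour[OF d_less u_in v_in] nonadj
  by (fastforce simp: types_def I_def X_def)

lemma type_obtain:
  assumes "P \<in> types"
  obtains w where "w \<in> cell P" "w \<in> X" "trace w = P"
  using assms by (auto simp: types_def cell_def)

lemma finite_cell [simp]: "finite (cell P)"
  by (simp add: cell_def)

lemma adjacent_traces_disjoint: "w' \<in> N w \<Longrightarrow> trace w \<inter> trace w' = {}"
  using disjoint_adj by blast

lemma mem_X_of_N: "\<lbrakk>x \<in> I; p \<in> N x\<rbrakk> \<Longrightarrow> p \<in> X"
  using I_in_X by blast

lemma card_X_minus_N:
  assumes "x \<in> I"
  shows "real (card (X - N x)) = real n - 3 * real d + real c"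
proof -
  have "card (X - N x) = card X - d"
    using assms I_in_X I_subset card_N by (subst card_Diff_subset) auto
  moreover have "d \<le> card X"
    using assms I_in_X[OF assms] I_subset card_N card_mono[OF finite_X] by fastforce
  ultimately show ?thesis using card_X by simp
qed

lemma no_three_disjoint:
  assumes x: "x \<in> I"
    and A: "A \<subseteq> X - N x" "B \<subseteq> X - N x" "C \<subseteq> X - N x"
    and disj: "A \<inter> B = {}" "A \<inter> C = {}" "B \<inter> C = {}"
    and "c \<le> card A" "c \<le> card B" "c \<le> card C"
  shows False
proof -
  have "3 * c \<le> card (X - N x)"
    using card_disjoint3_le[OF _ A disj] assms by simp
  then have "3 * real c \<le> real n - 3 * real d + real c"
    using card_X_minus_N[OF x] by (metis of_nat_le_iff of_nat_mult of_nat_numeral)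
  then show False using n_less by linarith
qed

text \<open>
  A vertex \<open>r\<close> of trace \<open>P\<close> and a vertex \<open>z \<in> I - P\<close> have at least \<open>c\<close> common neighbours.  These lie
  in \<open>X\<close>, and outside \<open>N x\<close> if \<open>x \<in> P\<close>.  An adjacency between \<open>z\<^sub>i\<close> and \<open>r\<^sub>j\<close> makes the sets that
  belong to \<open>i\<close> and \<open>j\<close> disjoint.
\<close>
lemma no_three_types:
  assumes x: "x \<in> P1" "x \<in> P2" "x \<in> P3"
    and P: "P1 \<in> types" "P2 \<in> types" "P3 \<in> types"
    and z: "z1 \<in> I - P1" "z2 \<in> I - P2" "z3 \<in> I - P3"
    and cross: "z1 \<in> P2 \<or> z2 \<in> P1" "z1 \<in> P3 \<or> z3 \<in> P1" "z2 \<in> P3 \<or> z3 \<in> P2"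
  shows False
proof -
  obtain r1 r2 r3 where r: "r1 \<in> X" "trace r1 = P1" "r2 \<in> X" "trace r2 = P2" "r3 \<in> X" "trace r3 = P3"
    using type_obtain[OF P(1)] type_obtain[OF P(2)] type_obtain[OF P(3)] by metis
  have xI: "x \<in> I" using x P type_subset by blast
  let ?C = "\<lambda>z r. N z \<inter> N r"
  have sub: "?C z r \<subseteq> X - N x" if "z \<in> I" "x \<in> trace r" for z r
    using that I_in_X disjoint_adj sym by fastforce
  have ge: "c \<le> card (?C z r)" if "z \<in> I - trace r" "r \<in> X" for z r
    using that I_subset X_subset sym by (intro codegree_ge) auto
  have disj: "?C z r \<inter> ?C z' r' = {}" if "z \<in> trace r' \<or> z' \<in> trace r" for z r z' r'
    using that disjoint_adj sym by blast
  show False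
  proof (rule no_three_disjoint[OF xI])
    show "?C z1 r1 \<subseteq> X - N x" "?C z2 r2 \<subseteq> X - N x" "?C z3 r3 \<subseteq> X - N x"
      using sub[of z1 r1] sub[of z2 r2] sub[of z3 r3] x r z by simp_all
    show "c \<le> card (?C z1 r1)" "c \<le> card (?C z2 r2)" "c \<le> card (?C z3 r3)"
      using ge[of z1 r1] ge[of z2 r2] ge[of z3 r3] r z by simp_all
    show "?C z1 r1 \<inter> ?C z2 r2 = {}" "?C z1 r1 \<inter> ?C z3 r3 = {}" "?C z2 r2 \<inter> ?C z3 r3 = {}"
      using disj[of z1 r2 z2 r1] disj[of z1 r3 z3 r1] disj[of z2 r3 z3 r2] cross r by simp_all
  qed
qed

text \<open>
  By symmetry let \<open>P\<close> be not contained in \<open>Q\<close>, and suppose that \<open>p \<in> P \<inter> Q\<close> is missing from \<open>R\<close>.  Then a point outside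
  \<open>P\<close>, a point of \<open>P - Q\<close> and the point \<open>p\<close> violate \<open>no_three_types\<close>.
\<close>
lemma sunflower:
  assumes "P \<in> types" "Q \<in> types" "R \<in> types" "P \<noteq> Q" "P \<noteq> I" "Q \<noteq> I"
    and "y \<in> P" "y \<in> Q" "y \<in> R"
  shows "P \<inter> Q \<subseteq> R"
proof -
  have *: "P \<inter> Q \<subseteq> R"
    if PQ: "P \<in> types" "Q \<in> types" "P \<noteq> I" "y \<in> P" "y \<in> Q" "\<not> P \<subseteq> Q" for P Q
  proof
    fix p assume p: "p \<in> P \<inter> Q"
    obtain z1 z2 where "z1 \<in> I - P" "z2 \<in> P - Q"
      using PQ type_subset by blast
    then show "p \<in> R"
      using no_three_types[of y P Q R z1 z2 p] PQ assms p type_subset by blast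
  qed
  show ?thesis
    using *[of P Q] *[of Q P] assms by blast
qed

lemma type_through_two:
  assumes P: "P \<in> types" and xy: "x \<in> I - P" "y \<in> I - P"
  obtains R where "R \<in> types" "x \<in> R" "y \<in> R" "R \<inter> P = {}" "R \<noteq> I"
proof -
  obtain q where q: "q \<in> X" "trace q = P" using type_obtain[OF P] by blast
  have "N x \<inter> N y \<inter> N q \<noteq> {}"
    using xy q I_independent I_subset X_subset sym
    by (intro independent_triple_common_neighbour[OF d_less]) auto
  then obtain r where r: "r \<in> N x" "r \<in> N y" "r \<in> N q" by blast
  then have "r \<in> X" "trace r \<inter> P = {}" "x \<in> trace r" "y \<in> trace r"
    using mem_X_of_N xy adjacent_traces_disjoint[of r q] q sym by auto
  then show ?thesis
    using that[of "trace r"] type_nonempty[OF P] type_subset[OF P] by (auto simp: types_def)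
qed

lemma type_avoiding_two:
  assumes q: "q \<in> X" "q' \<in> X" "q' \<notin> N q" and x: "x \<in> I" "x \<notin> trace q" "x \<notin> trace q'"
  obtains R where "R \<in> types" "x \<in> R" "R \<inter> trace q = {}" "R \<inter> trace q' = {}"
proof -
  have "N x \<inter> N q \<inter> N q' \<noteq> {}"
    using q x I_subset X_subset sym
    by (intro independent_triple_common_neighbour[OF d_less]) auto
  then obtain r where r: "r \<in> N x" "r \<in> N q" "r \<in> N q'" by blast
  then have "r \<in> X" "x \<in> trace r" "trace r \<inter> trace q = {}" "trace r \<inter> trace q' = {}"
    using mem_X_of_N x adjacent_traces_disjoint sym by blast+
  then show ?thesis using that by (auto simp: types_def)
qed

text \<open>
  Two points of \<open>P - Q\<close> lie in a common type \<open>R'\<close> disjoint from \<open>Q\<close>, which therefore differs from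
  \<open>P\<close>; by \<open>sunflower\<close> no type contains just one of two points of \<open>P \<inter> R'\<close>.
\<close>
lemma difference_inseparable:
  assumes "P \<in> types" "Q \<in> types" "R \<in> types" "P \<noteq> I" "P \<inter> Q \<noteq> {}" "y \<in> P - Q" "y \<in> R"
  shows "P - Q \<subseteq> R"
proof
  fix x assume x: "x \<in> P - Q"
  obtain R' where "R' \<in> types" "x \<in> R'" "y \<in> R'" "R' \<inter> Q = {}" "R' \<noteq> I"
    using type_through_two[of Q x y] assms x type_subset by blast
  then show "x \<in> R"
    using sunflower[of P R' R y] assms x by blast
qed

text \<open>
  The hypothesis says that \<open>u, v, x, y\<close> is a dominating 4-cycle (degenerate if \<open>x = y\<close>),
  so the neighbourhoods of its two pairs of opposite vertices cover the whole graph.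
\<close>
lemma hitting_pair_bound:
  assumes "x \<in> I" "y \<in> I" and hit: "\<And>P. P \<in> types \<Longrightarrow> x \<in> P \<or> y \<in> P"
  shows "n + 2 * c \<le> 4 * d"
proof -
  have "X \<subseteq> N x \<union> N y"
  proof
    fix w assume "w \<in> X"
    then show "w \<in> N x \<union> N y" using hit[of "trace w"] sym by (auto simp: types_def)
  qed
  then have "card X \<le> card (N x \<union> N y)" by (intro card_mono) auto
  moreover have "card (N x \<union> N y) + codeg x y = d + d"
    using card_Un_Int[of "N x" "N y"] card_N[of x] card_N[of y] assms(1,2) I_subset by fastforce
  moreover have "c \<le> codeg x y"
    using assms codegree_ge I_independent I_subset by blast
  ultimately show ?thesis using card_X by linarith
qed

text \<open>
  Here the types other than \<open>I\<close> come in complementary pairs.  Three types through the same point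
  would give three disjoint sets of at least \<open>c\<close> vertices, one in each of the complementary cells,
  that avoid the neighbourhood of that point.  So there are at most two complementary pairs, and
  some two points of \<open>I\<close> are separated by all of them; these two points hit every type.
\<close>
lemma complementary_types_bound:
  assumes compl: "\<And>w w'. \<lbrakk>w \<in> X; w' \<in> X; w' \<in> N w\<rbrakk> \<Longrightarrow> trace w \<union> trace w' = I"
  shows "n + 2 * c \<le> 4 * d"
proof -
  have nbr: "N z \<inter> N r \<subseteq> cell (I - P)" "c \<le> card (N z \<inter> N r)"
    if "r \<in> cell P" "z \<in> I - P" for r z P
  proof -
    show "N z \<inter> N r \<subseteq> cell (I - P)"
    proof
      fix p assume p: "p \<in> N z \<inter> N r"
      then have "p \<in> X" using mem_X_of_N that by blast
      then have "trace r \<union> trace p = I" "trace r \<inter> trace p = {}"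
        using compl[of r p] p that adjacent_traces_disjoint by (auto simp: cell_def)
      then show "p \<in> cell (I - P)" using \<open>p \<in> X\<close> that by (auto simp: cell_def)
    qed
    show "c \<le> card (N z \<inter> N r)"
      using that sym I_subset X_subset by (intro codegree_ge) (auto simp: cell_def)
  qed
  have complement: "I - P \<in> types" if P: "P \<in> types" "P \<noteq> I" for P
  proof -
    obtain r where r: "r \<in> cell P" using type_obtain[OF P(1)] by blast
    obtain z where z: "z \<in> I - P" using P type_subset by blast
    have "N z \<inter> N r \<noteq> {}" using nbr(2)[OF r z] c_pos by auto
    then have "cell (I - P) \<noteq> {}" using nbr(1)[OF r z] by blast
    then show ?thesis by (auto simp: types_def cell_def)
  qed
  have at_most_two: "P3 = P1 \<or> P3 = P2"
    if P: "P1 \<in> types" "P2 \<in> types" "P3 \<in> types" "P1 \<noteq> I" "P2 \<noteq> I" "P3 \<noteq> I" "P1 \<noteq> P2"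
      "x \<in> P1" "x \<in> P2" "x \<in> P3" for P1 P2 P3 x
  proof (rule ccontr)
    assume ne: "\<not> ?thesis"
    have sub: "P1 \<subseteq> I" "P2 \<subseteq> I" "P3 \<subseteq> I" using P type_subset by auto
    have xI: "x \<in> I" using P sub by blast
    obtain r1 r2 r3 where r: "r1 \<in> cell P1" "r2 \<in> cell P2" "r3 \<in> cell P3"
      using type_obtain[OF P(1)] type_obtain[OF P(2)] type_obtain[OF P(3)] by metis
    obtain z1 z2 z3 where z: "z1 \<in> I - P1" "z2 \<in> I - P2" "z3 \<in> I - P3"
      using sub P by blast
    have disj: "cell (I - P) \<inter> cell (I - Q) = {}" if "P \<subseteq> I" "Q \<subseteq> I" "P \<noteq> Q" for P Q
      using that by (auto simp: cell_def)
    have out: "N z \<inter> N r \<subseteq> X - N x" if "r \<in> cell P" "z \<in> I - P" "x \<in> P" for z r P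
    proof
      fix q assume "q \<in> N z \<inter> N r"
      then have "q \<in> X" "x \<notin> trace q"
        using nbr(1)[OF that(1,2)] that(3) by (auto simp: cell_def)
      then show "q \<in> X - N x" using xI sym by blast
    qed
    show False
    proof (rule no_three_disjoint[OF xI])
      show "N z1 \<inter> N r1 \<subseteq> X - N x" "N z2 \<inter> N r2 \<subseteq> X - N x" "N z3 \<inter> N r3 \<subseteq> X - N x"
        using out r z P by blast+
      show "c \<le> card (N z1 \<inter> N r1)" "c \<le> card (N z2 \<inter> N r2)" "c \<le> card (N z3 \<inter> N r3)"
        using nbr(2) r z by blast+
      show "N z1 \<inter> N r1 \<inter> (N z2 \<inter> N r2) = {}"
        using nbr(1)[OF r(1) z(1)] nbr(1)[OF r(2) z(2)] disj[OF sub(1,2)] P(7) by blast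
      show "N z1 \<inter> N r1 \<inter> (N z3 \<inter> N r3) = {}"
        using nbr(1)[OF r(1) z(1)] nbr(1)[OF r(3) z(3)] disj[OF sub(1,3)] ne by blast
      show "N z2 \<inter> N r2 \<inter> (N z3 \<inter> N r3) = {}"
        using nbr(1)[OF r(2) z(2)] nbr(1)[OF r(3) z(3)] disj[OF sub(2,3)] ne by blast
    qed
  qed
  show ?thesis
  proof (cases "types \<subseteq> {I}")
    case True
    then show ?thesis using I_nonempty hitting_pair_bound by blast
  next
    case False
    then obtain P where P: "P \<in> types" "P \<noteq> I" by blast
    then obtain x where x: "x \<in> P" using type_nonempty by blast
    have xI: "x \<in> I" using P x type_subset by blast
    show ?thesis
    proof (cases "\<exists>Q\<in>types. Q \<noteq> I \<and> Q \<noteq> P \<and> x \<in> Q")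
      case True
      then obtain Q where Q: "Q \<in> types" "Q \<noteq> I" "Q \<noteq> P" "x \<in> Q" by blast
      have PQ: "R = P \<or> R = Q" if "R \<in> types" "R \<noteq> I" "x \<in> R" for R
        using at_most_two[of P Q R x] P Q x that by blast
      have PQ': "R = I - P \<or> R = I - Q" if "R \<in> types" "x \<notin> R" for R
        using PQ[of "I - R"] complement[OF that(1)] that xI type_nonempty[OF that(1)] type_subset[OF that(1)]
        by blast
      show ?thesis
      proof (cases "P \<union> Q = I")
        case True
        \<comment> \<open>Replacing \<open>x\<close> by a point outside \<open>Q\<close> exchanges \<open>Q\<close> with its complement.\<close>
        then obtain x' y where "x' \<in> P - Q" "y \<in> Q - P"
          using P Q type_subset by blast
        then show ?thesis
          using hitting_pair_bound[of x' y] PQ PQ' P Q type_subset by blast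
      next
        case False
        then obtain y where "y \<in> I - (P \<union> Q)" using P Q type_subset by blast
        then show ?thesis
          using hitting_pair_bound[of x y] PQ' xI by blast
      qed
    next
      case False
      obtain y where y: "y \<in> I - P" using P type_subset by blast
      have "R = I - P" if R: "R \<in> types" "x \<notin> R" for R
      proof -
        have "I - R \<in> types" "I - R \<noteq> I" "x \<in> I - R"
          using complement[OF R(1)] R xI type_nonempty[OF R(1)] type_subset[OF R(1)] by auto
        then have "I - R = P" using False by metis
        then show ?thesis using type_subset[OF R(1)] by blast
      qed
      then show ?thesis
        using hitting_pair_bound[of x y] y xI by blast
    qed
  qed
qed

end

section \<open>Splitting the common neighbourhood into three classes\<close>

context dense_tight_pair
begin

definition three_classes :: "'a set \<Rightarrow> 'a set \<Rightarrow> 'a set \<Rightarrow> bool" where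
  "three_classes L M R \<longleftrightarrow>
     I = L \<union> M \<union> R \<and> L \<inter> M = {} \<and> L \<inter> R = {} \<and> M \<inter> R = {} \<and>
     L \<noteq> {} \<and> M \<noteq> {} \<and> R \<noteq> {} \<and>
     L \<in> types \<and> M \<in> types \<and> R \<in> types \<and>
     L \<union> M \<in> types \<and> L \<union> R \<in> types \<and> M \<union> R \<in> types \<and>
     (\<forall>P\<in>types. P = L \<or> P = M \<or> P = R \<or> P = L \<union> M \<or> P = L \<union> R \<or> P = M \<union> R \<or> P = I)"

lemma three_classes_permute:
  assumes "three_classes L M R"
  shows "three_classes M L R" and "three_classes R L M"
proof -
  note D = assms[unfolded three_classes_def]
  have P: "P = L \<or> P = M \<or> P = R \<or> P = L \<union> M \<or> P = L \<union> R \<or> P = M \<union> R \<or> P = I" if "P \<in> types" for P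
  proof -
    have "\<forall>P\<in>types. P = L \<or> P = M \<or> P = R \<or> P = L \<union> M \<or> P = L \<union> R \<or> P = M \<union> R \<or> P = I"
      using D by (elim conjE)
    then show ?thesis using that by (rule bspec)
  qed
  have sets: "M \<union> L = L \<union> M" "R \<union> L = L \<union> R" "R \<union> M = M \<union> R" "L \<union> M \<union> R = I" "L \<union> R \<union> M = I"
    "M \<inter> L = L \<inter> M" "R \<inter> L = L \<inter> R" "R \<inter> M = M \<inter> R"
    using D by auto
  show "three_classes M L R" "three_classes R L M"
    unfolding three_classes_def sets
    by (intro conjI ballI; (drule P, elim disjE; simp) | use D in simp)+
qed

text \<open>
  Let \<open>A\<close> and \<open>B\<close> be the disjoint traces of \<open>w\<close> and \<open>w'\<close>, and pick \<open>a \<in> A\<close>, \<open>b \<in> B\<close>.  There are types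
  \<open>C1\<close> through \<open>x, b\<close> and \<open>C2\<close> through \<open>x, a\<close>.  The three sets \<open>C2 - C1\<close>, \<open>C1 - C2\<close> and \<open>C1 \<inter> C2\<close>
  are not split by any type.  A further point \<open>y\<close> would lie in a type with \<open>x\<close>, and then the types
  joining \<open>x\<close> to \<open>a\<close>, to \<open>b\<close> and to \<open>y\<close> would contradict \<open>no_three_types\<close>.  So the three sets
  exhaust \<open>I\<close>.
\<close>
lemma separated_edge_classes:
  assumes edge: "w \<in> X" "w' \<in> X" "w' \<in> N w" and x: "x \<in> I" "x \<notin> trace w" "x \<notin> trace w'"
  obtains L M R where "three_classes L M R"
proof -
  define A B where "A = trace w" and "B = trace w'"
  have A: "A \<in> types" "x \<notin> A" and B: "B \<in> types" "x \<notin> B"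
    using edge x by (simp_all add: A_def B_def types_def)
  have "A \<inter> B = {}" using adjacent_traces_disjoint[OF edge(3)] by (simp add: A_def B_def)
  with A B x have AB: "A \<in> types" "B \<in> types" "A \<inter> B = {}" "x \<notin> A" "x \<notin> B" "A \<noteq> I" "B \<noteq> I"
    by auto
  obtain a b where ab: "a \<in> A" "b \<in> B"
    using type_nonempty[OF AB(1)] type_nonempty[OF AB(2)] by blast
  have I: "a \<in> I" "b \<in> I" "A \<subseteq> I" "B \<subseteq> I"
    using ab type_subset[OF AB(1)] type_subset[OF AB(2)] by auto
  obtain C1 where C1: "C1 \<in> types" "x \<in> C1" "b \<in> C1" "C1 \<inter> A = {}" "C1 \<noteq> I"
    using type_through_two[OF AB(1), of x b] AB ab I x by blast
  obtain C2 where C2: "C2 \<in> types" "x \<in> C2" "a \<in> C2" "C2 \<inter> B = {}" "C2 \<noteq> I"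
    using type_through_two[OF AB(2), of x a] AB ab I x by blast
  define L M R where "L = C2 - C1" and "M = C1 - C2" and "R = C1 \<inter> C2"
  have mem: "a \<in> L" "b \<in> M" "x \<in> R" "C1 = M \<union> R" "C2 = L \<union> R"
    using C1 C2 ab by (auto simp: L_def M_def R_def)
  have disj: "L \<inter> M = {}" "L \<inter> R = {}" "M \<inter> R = {}"
    by (auto simp: L_def M_def R_def)
  have L_class: "L \<subseteq> P" if "P \<in> types" "y \<in> L" "y \<in> P" for P y
    using difference_inseparable[of C2 C1 P y] that C1 C2 by (auto simp: L_def)
  have M_class: "M \<subseteq> P" if "P \<in> types" "y \<in> M" "y \<in> P" for P y
    using difference_inseparable[of C1 C2 P y] that C1 C2 by (auto simp: M_def)
  have R_class: "R \<subseteq> P" if "P \<in> types" "y \<in> R" "y \<in> P" for P y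
    using sunflower[of C1 C2 P y] that C1 C2 ab by (auto simp: R_def)
  have cover: "y \<in> L \<union> M \<union> R" if y: "y \<in> I" for y
  proof (rule ccontr)
    assume out: "y \<notin> L \<union> M \<union> R"
    obtain Q where Q: "Q \<in> types" "x \<in> Q" "y \<in> Q" "Q \<noteq> I" "Q \<inter> A = {} \<or> Q \<inter> B = {}"
    proof (cases "y \<in> A")
      case True
      then have "y \<in> I - B" "x \<in> I - B" using AB x y by auto
      then show ?thesis using type_through_two[OF AB(2), of x y] that by metis
    next
      case False
      then have "y \<in> I - A" "x \<in> I - A" using AB x y by auto
      then show ?thesis using type_through_two[OF AB(1), of x y] that by metis
    qed
    have yC: "y \<notin> C1" "y \<notin> C2" using out mem(4,5) by auto
    have "a \<notin> Q"
    proof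
      assume "a \<in> Q"
      have "C2 \<inter> Q \<subseteq> A"
      proof (rule sunflower[OF C2(1) Q(1) AB(1)])
        show "C2 \<noteq> Q" using Q(3) yC by blast
      qed (use C2 Q \<open>a \<in> Q\<close> ab in auto)
      then show False using C2 Q AB by blast
    qed
    then show False
      using no_three_types[OF C1(2) C2(2) Q(2) C1(1) C2(1) Q(1), of y b a] yC C1 C2 Q AB ab I y
      by blast
  qed
  have I_eq: "I = L \<union> M \<union> R"
    using cover type_subset[OF C1(1)] type_subset[OF C2(1)] by (auto simp: L_def M_def R_def)
  have split: "P = L \<or> P = M \<or> P = R \<or> P = L \<union> M \<or> P = L \<union> R \<or> P = M \<union> R \<or> P = I" if P: "P \<in> types" for P
  proof -
    define l m r where "l = L \<inter> P" and "m = M \<inter> P" and "r = R \<inter> P"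
    have "l = L \<or> l = {}" "m = M \<or> m = {}" "r = R \<or> r = {}"
      unfolding l_def m_def r_def using L_class[OF P] M_class[OF P] R_class[OF P] by blast+
    moreover have "P = l \<union> m \<union> r"
      using type_subset[OF P] I_eq by (auto simp: l_def m_def r_def)
    moreover have "P \<noteq> {}" by (rule type_nonempty[OF P])
    ultimately show ?thesis unfolding I_eq by (elim disjE) simp_all
  qed
  have A_eq: "A = L" and B_eq: "B = M"
    using split[OF AB(1)] split[OF AB(2)] AB ab mem disj I_eq by auto
  \<comment> \<open>If \<open>R\<close> were not a type, \<open>w\<close> would be adjacent to all vertices of trace \<open>M\<close>, of which there
    are at least \<open>c\<close>, and to \<open>c\<close> further vertices of \<open>X\<close>: too many for \<open>card_N_Int_X\<close>.\<close>
  have R_type: "R \<in> types"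
  proof (rule ccontr)
    assume noR: "R \<notin> types"
    have wc: "w \<in> cell L" and wc': "w' \<in> cell M" using edge A_eq B_eq A_def B_def by (auto simp: cell_def)
    have all: "cell M \<subseteq> N w"
    proof
      fix q assume q: "q \<in> cell M"
      show "q \<in> N w"
      proof (rule ccontr)
        assume qw: "q \<notin> N w"
        have tr: "q \<in> X" "trace q = M" "trace w = L" using q wc by (auto simp: cell_def)
        have xLM: "x \<notin> trace w" "x \<notin> trace q" unfolding tr using mem(3) disj by auto
        obtain Q where "Q \<in> types" "x \<in> Q" "Q \<inter> trace w = {}" "Q \<inter> trace q = {}"
          using type_avoiding_two[OF edge(1) tr(1) qw x(1) xLM] by metis
        then have Q: "Q \<in> types" "x \<in> Q" "Q \<inter> L = {}" "Q \<inter> M = {}" by (simp_all add: tr)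
        then have "Q = R" using split[OF Q(1)] mem disj I_eq by auto
        then show False using Q noR by simp
      qed
    qed
    obtain r where r: "r \<in> cell (L \<union> R)" using type_obtain[OF C2(1)] mem by blast
    have "N b \<inter> N r \<subseteq> cell M"
    proof
      fix q assume q: "q \<in> N b \<inter> N r"
      then have "q \<in> X" "b \<in> trace q" "trace q \<inter> (L \<union> R) = {}"
        using I mem_X_of_N sym adjacent_traces_disjoint[of q r] r by (auto simp: cell_def)
      then have "trace q \<in> types" by (auto simp: types_def)
      then have "trace q = M"
        using split[of "trace q"] \<open>b \<in> trace q\<close> \<open>trace q \<inter> (L \<union> R) = {}\<close> mem disj I_eq by auto
      then show "q \<in> cell M" using \<open>q \<in> X\<close> by (simp add: cell_def)
    qed
    moreover have "c \<le> card (N b \<inter> N r)"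
      using I r mem disj I_subset X_subset sym by (intro codegree_ge) (auto simp: cell_def)
    ultimately have cM: "c \<le> card (cell M)" by (meson card_mono finite_cell le_trans)
    have "c \<le> card (N x \<inter> N w)"
      using x edge I_subset X_subset sym by (intro codegree_ge) auto
    moreover have "(N x \<inter> N w) \<inter> cell M = {}"
    proof (intro equals0I)
      fix q assume q: "q \<in> N x \<inter> N w \<inter> cell M"
      then have "x \<in> trace q" "trace q = M" using x(1) sym by (auto simp: cell_def)
      then show False using mem(3) disj by blast
    qed
    ultimately have "2 * c \<le> card ((N x \<inter> N w) \<union> cell M)"
      using cM by (simp add: card_Un_disjoint)
    also have "\<dots> \<le> card (N w \<inter> X)"
      using all mem_X_of_N x by (intro card_mono) (auto simp: cell_def)
    finally have "2 * real c \<le> real (card (N w \<inter> X))" by simp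
    then show False
      using card_N_Int_X[OF edge(1)] surplus_nonneg[OF edge(1)] t_le[of w] d_less by linarith
  qed
  have "L \<union> M \<in> types"
  proof -
    obtain Q where Q: "Q \<in> types" "a \<in> Q" "b \<in> Q" "Q \<inter> R = {}"
    proof -
      have "a \<in> I - R" "b \<in> I - R" using I mem(1,2) disj by auto
      from type_through_two[OF R_type this] show ?thesis using that by metis
    qed
    then have "Q = L \<union> M" using split[OF Q(1)] mem disj I_eq by auto
    then show ?thesis using Q by simp
  qed
  moreover have "L \<in> types" "M \<in> types" "L \<union> R \<in> types" "M \<union> R \<in> types"
    using AB(1,2) C1(1) C2(1) by (simp_all add: A_eq B_eq flip: mem(4,5))
  ultimately have "three_classes L M R"
    unfolding three_classes_def using I_eq disj mem(1-3) R_type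
    by (intro conjI ballI split) auto
  then show ?thesis using that by blast
qed

end

section \<open>Counting with three classes\<close>

text \<open>
  The arithmetic behind \<open>three_classes_quadratic\<close>.  In terms of the slacks \<open>a\<^sub>i = v\<^sub>i - c\<close> and
  \<open>x\<^sub>i = m\<^sub>i - (4 c - d - v\<^sub>j\<^sub>k)\<close> the hypothesis \<open>total\<close> becomes
  \<open>(3 c - d) (4 d + 2 c - n) \<le> a\<^sub>1 x\<^sub>1 + a\<^sub>2 x\<^sub>2 + a\<^sub>3 x\<^sub>3\<close>, and the right-hand side is at most the product
  of the sums of the \<open>a\<^sub>i\<close> and of the \<open>x\<^sub>i\<close>; the second sum is \<open>3 n - 6 d - 14 c\<close> minus twice the
  first.
\<close>
lemma three_classes_quadratic_arith:
  fixes n d c m1 m2 m3 v1 v2 v3 v12 v13 v23 vI :: real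
  assumes deg: "v1 + v12 + v13 + vI = d"
    and D: "v2 + v3 + v23 = n - 3 * d + c" "v1 + v3 + v13 = n - 3 * d + c" "v1 + v2 + v12 = n - 3 * d + c"
    and m: "m1 + m2 + m3 = c"
    and v: "c \<le> v1" "c \<le> v2" "c \<le> v3"
    and pair: "4 * c - d - m1 \<le> v23" "4 * c - d - m2 \<le> v13" "4 * c - d - m3 \<le> v12"
    and total: "v23 * (d - c - m1 - v1) + v13 * (d - c - m2 - v2) + v12 * (d - c - m3 - v3) + vI * (d - c)
      \<le> 2 * (d\<^sup>2 - c * (n - d))"
  shows "\<exists>y\<ge>0. 2 * y\<^sup>2 - (3 * n - 6 * d - 14 * c) * y + (3 * c - d) * (4 * d + 2 * c - n) \<le> 0"
proof -
  define a1 a2 a3 where "a1 = v1 - c" and "a2 = v2 - c" and "a3 = v3 - c"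
  define x1 x2 x3 where "x1 = m1 - (4 * c - d - v23)" and "x2 = m2 - (4 * c - d - v13)"
    and "x3 = m3 - (4 * c - d - v12)"
  define V where "V = a1 + a2 + a3"
  have a: "0 \<le> a1" "0 \<le> a2" "0 \<le> a3" and x: "0 \<le> x1" "0 \<le> x2" "0 \<le> x3"
    using v pair by (auto simp: a1_def a2_def a3_def x1_def x2_def x3_def)
  have V: "0 \<le> V" "a1 \<le> V" "a2 \<le> V" "a3 \<le> V" using a by (auto simp: V_def)
  have e: "v1 = c + a1" "v2 = c + a2" "v3 = c + a3"
    "v23 = n - 3 * d - c - a2 - a3" "v13 = n - 3 * d - c - a1 - a3" "v12 = n - 3 * d - c - a1 - a2"
    "m1 = x1 + 5 * c + 2 * d - n + a2 + a3" "m2 = x2 + 5 * c + 2 * d - n + a1 + a3"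
    "m3 = x3 + 5 * c + 2 * d - n + a1 + a2"
    using D by (auto simp: a1_def a2_def a3_def x1_def x2_def x3_def)
  have vI: "vI = d - (v1 + v12 + v13)" using deg by simp
  have sx: "x3 = 3 * n - 6 * d - 14 * c - 2 * V - x1 - x2"
    using m e by (simp add: V_def)
  have "(3 * c - d) * (4 * d + 2 * c - n) - (a1 * x1 + a2 * x2 + a3 * x3) \<le> 0"
    using total unfolding vI e sx V_def by (simp add: algebra_simps power2_eq_square)
  moreover have "a1 * x1 + a2 * x2 + a3 * x3 \<le> V * x1 + V * x2 + V * x3"
    using V x by (intro add_mono mult_right_mono) auto
  moreover have "V * x1 + V * x2 + V * x3 = V * (3 * n - 6 * d - 14 * c - 2 * V)"
    unfolding sx by (simp add: algebra_simps)
  ultimately have "2 * V\<^sup>2 - (3 * n - 6 * d - 14 * c) * V + (3 * c - d) * (4 * d + 2 * c - n) \<le> 0"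
    by (simp add: algebra_simps power2_eq_square)
  then show ?thesis using V by blast
qed

context dense_tight_pair
begin

lemma card_types_in:
  assumes "finite \<P>"
  shows "card {w \<in> X. trace w \<in> \<P>} = (\<Sum>P\<in>\<P>. card (cell P))"
proof -
  have "{w \<in> X. trace w \<in> \<P>} = (\<Union>P\<in>\<P>. cell P)" by (auto simp: cell_def)
  also have "card \<dots> = (\<Sum>P\<in>\<P>. card (cell P))"
    using assms by (intro card_UN_disjoint) (auto simp: cell_def)
  finally show ?thesis .
qed

lemma trace_in_types: "w \<in> X \<Longrightarrow> trace w \<in> types"
  by (simp add: types_def)

abbreviation \<nu> :: "'a set \<Rightarrow> real" where "\<nu> P \<equiv> real (card (cell P))"

lemma three_classesD:
  assumes "three_classes L M R"
  shows "I = L \<union> M \<union> R" "L \<inter> M = {}" "L \<inter> R = {}" "M \<inter> R = {}" "L \<noteq> {}" "M \<noteq> {}" "R \<noteq> {}"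
    "L \<in> types" "M \<union> R \<in> types"
  by (insert assms[unfolded three_classes_def], elim conjE, assumption)+

lemma three_classes_cases:
  assumes "three_classes L M R" "P \<in> types"
  shows "P = L \<or> P = M \<or> P = R \<or> P = L \<union> M \<or> P = L \<union> R \<or> P = M \<union> R \<or> P = L \<union> M \<union> R"
proof -
  have "\<forall>P\<in>types. P = L \<or> P = M \<or> P = R \<or> P = L \<union> M \<or> P = L \<union> R \<or> P = M \<union> R \<or> P = I"
    using assms(1) unfolding three_classes_def by (elim conjE)
  then show ?thesis using assms(2) unfolding three_classesD(1)[OF assms(1)] by (rule bspec)
qed

lemma three_classes_mem:
  assumes T: "three_classes L M R" and P: "P \<in> types"
  shows "x \<in> L \<Longrightarrow> x \<in> P \<longleftrightarrow> P \<in> {L, L \<union> M, L \<union> R, L \<union> M \<union> R}"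
    and "x \<in> L \<Longrightarrow> x \<notin> P \<longleftrightarrow> P \<in> {M, R, M \<union> R}"
    and "P \<inter> (M \<union> R) = {} \<Longrightarrow> P = L"
    and "\<lbrakk>y \<in> M; z \<in> R; y \<in> P; z \<in> P; P \<inter> L = {}\<rbrakk> \<Longrightarrow> P = M \<union> R"
proof -
  note D = three_classesD(2-7)[OF T]
  show "x \<in> L \<Longrightarrow> x \<in> P \<longleftrightarrow> P \<in> {L, L \<union> M, L \<union> R, L \<union> M \<union> R}"
    using three_classes_cases[OF assms] D(1-3) by (elim disjE) auto
  show "x \<in> L \<Longrightarrow> x \<notin> P \<longleftrightarrow> P \<in> {M, R, M \<union> R}"
    using three_classes_cases[OF assms] D(1-3) by (elim disjE) auto
  show "P \<inter> (M \<union> R) = {} \<Longrightarrow> P = L"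
    using three_classes_cases[OF assms] D by (elim disjE) auto
  show "\<lbrakk>y \<in> M; z \<in> R; y \<in> P; z \<in> P; P \<inter> L = {}\<rbrakk> \<Longrightarrow> P = M \<union> R"
    using three_classes_cases[OF assms] D by (elim disjE) auto
qed

lemma three_classes_degree:
  assumes T: "three_classes L M R"
  shows "\<nu> L + \<nu> (L \<union> M) + \<nu> (L \<union> R) + \<nu> I = d" (is ?A)
    and "\<nu> M + \<nu> R + \<nu> (M \<union> R) = real n - 3 * real d + real c" (is ?B)
proof -
  note T' = three_classesD[OF T]
  obtain x where x: "x \<in> L" using T'(5) by blast
  then have xI: "x \<in> I" using T'(1) by blast
  have adj: "w \<in> N x \<longleftrightarrow> w \<in> X \<and> x \<in> trace w" for w
    using mem_X_of_N[OF xI] sym xI by blast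
  have "N x = {w \<in> X. trace w \<in> {L, L \<union> M, L \<union> R, L \<union> M \<union> R}}"
    using adj three_classes_mem(1)[OF T trace_in_types x] by blast
  moreover have "L \<noteq> L \<union> M" "L \<noteq> L \<union> R" "L \<noteq> L \<union> M \<union> R" "L \<union> M \<noteq> L \<union> R"
      "L \<union> M \<noteq> L \<union> M \<union> R" "L \<union> R \<noteq> L \<union> M \<union> R"
    using T'(2-7) by auto
  moreover have "card (N x) = d" using xI I_subset card_N by blast
  ultimately have "card (cell L) + card (cell (L \<union> M)) + card (cell (L \<union> R)) + card (cell (L \<union> M \<union> R)) = d"
    using card_types_in[of "{L, L \<union> M, L \<union> R, L \<union> M \<union> R}"] by (simp add: add.assoc)
  then show ?A unfolding T'(1) by (simp flip: of_nat_add)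
  have "X - N x = {w \<in> X. trace w \<in> {M, R, M \<union> R}}"
    using adj three_classes_mem(2)[OF T trace_in_types x] by blast
  moreover have "M \<noteq> R" "M \<noteq> M \<union> R" "R \<noteq> M \<union> R" using T'(2-7) by auto
  ultimately have "card (cell M) + card (cell R) + card (cell (M \<union> R)) = card (X - N x)"
    using card_types_in[of "{M, R, M \<union> R}"] by (simp add: add.assoc)
  then show ?B using card_X_minus_N[OF xI] by (simp flip: of_nat_add)
qed

text \<open>
  A vertex of trace \<open>M \<union> R\<close> has all its neighbours in \<open>X\<close> in the cell of \<open>L\<close>, among them at least \<open>c\<close>
  neighbours of a given \<open>x \<in> L\<close>; this gives the first and the third claim.  A vertex \<open>w\<close> of trace
  \<open>L\<close> has at least \<open>c\<close> common neighbours with \<open>y \<in> M\<close> and as many with \<open>z \<in> R\<close>.  They lie in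
  \<open>N w \<inter> X\<close>, which is too small for two disjoint such sets, and their overlap has trace \<open>M \<union> R\<close>.
\<close>
lemma three_classes_cells:
  assumes T: "three_classes L M R"
  shows "real c \<le> \<nu> L"
    and "4 * real c - real d - real (card L) \<le> \<nu> (M \<union> R)"
    and "r \<in> cell (M \<union> R) \<Longrightarrow> real d - real c - real (card L) - \<nu> L \<le> surplus r"
proof -
  note T' = three_classesD[OF T]
  have opposite: "N r \<inter> X \<subseteq> cell L" if r: "r \<in> cell (M \<union> R)" for r
  proof
    fix q assume q: "q \<in> N r \<inter> X"
    then have "trace q \<inter> (M \<union> R) = {}"
      using adjacent_traces_disjoint[of q r] r by (auto simp: cell_def)
    then show "q \<in> cell L"
      using q three_classes_mem(3)[OF T trace_in_types, of q] by (simp add: cell_def)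
  qed
  have fin: "finite L" "finite M" "finite R" using finite_I unfolding T'(1) by auto
  have cardMR: "real (card (M \<union> R)) = real c - real (card L)"
  proof -
    have "L \<inter> (M \<union> R) = {}" using T'(2,3) by blast
    then have "card I = card L + card (M \<union> R)"
      unfolding T'(1) Un_assoc using fin by (simp add: card_Un_disjoint)
    then show ?thesis using card_I by simp
  qed
  obtain x y z where xyz: "x \<in> L" "y \<in> M" "z \<in> R" using T'(5-7) by blast
  then have inI: "x \<in> I" "y \<in> I" "z \<in> I" unfolding T'(1) by auto
  obtain r where r: "r \<in> cell (M \<union> R)" using type_obtain[OF T'(9)] by blast
  have "c \<le> card (N x \<inter> N r)"
  proof (intro codegree_ge)
    have "x \<notin> trace r" using r xyz(1) T'(2,3) by (auto simp: cell_def)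
    then show "r \<notin> N x" using inI(1) sym by blast
    show "x \<in> V" "r \<in> V" using inI(1) r I_subset X_subset by (auto simp: cell_def)
  qed
  also have "\<dots> \<le> card (cell L)"
    using opposite[OF r] mem_X_of_N[OF inI(1)] by (intro card_mono) auto
  finally show "real c \<le> \<nu> L" by simp
  show "real d - real c - real (card L) - \<nu> L \<le> surplus r" if r: "r \<in> cell (M \<union> R)" for r
  proof -
    have "card (N r \<inter> X) \<le> card (cell L)"
      by (intro card_mono opposite[OF r]) simp
    moreover have "r \<in> X" "t r = real c - real (card L)"
      using r cardMR by (auto simp: cell_def t_def)
    ultimately show ?thesis using card_N_Int_X[of r] by simp
  qed
  obtain w where w: "w \<in> X" "trace w = L" using type_obtain[OF T'(8)] by blast
  let ?A = "N w \<inter> N y" and ?B = "N w \<inter> N z"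
  have "c \<le> card ?A" "c \<le> card ?B"
  proof -
    have "y \<notin> trace w" "z \<notin> trace w" unfolding w(2) using xyz T'(2,3) by auto
    then have "y \<notin> N w" "z \<notin> N w" using inI by auto
    then show "c \<le> card ?A" "c \<le> card ?B"
      using w(1) inI I_subset X_subset by (auto intro!: codegree_ge)
  qed
  moreover have "card (?A \<union> ?B) + card (?A \<inter> ?B) = card ?A + card ?B"
    using card_Un_Int[of ?A ?B] by simp
  moreover have "card (?A \<inter> ?B) \<le> card (cell (M \<union> R))"
  proof (intro card_mono subsetI)
    fix q assume q: "q \<in> ?A \<inter> ?B"
    then have "q \<in> X" "y \<in> trace q" "z \<in> trace q" "trace w \<inter> trace q = {}"
      using mem_X_of_N[OF inI(2)] inI sym adjacent_traces_disjoint[of q w] by auto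
    then show "q \<in> cell (M \<union> R)"
      using three_classes_mem(4)[OF T trace_in_types xyz(2,3), of q] w(2)
      by (simp add: cell_def Int_commute)
  qed simp
  moreover have "card (?A \<union> ?B) \<le> card (N w \<inter> X)"
    using mem_X_of_N inI by (intro card_mono) auto
  moreover have "real (card (N w \<inter> X)) \<le> real d - 2 * real c + real (card L)"
    using card_N_Int_X[OF w(1)] surplus_nonneg[OF w(1)] w by (simp add: t_def)
  ultimately show "4 * real c - real d - real (card L) \<le> \<nu> (M \<union> R)" by linarith
qed

lemma surplus_cell_I:
  assumes "r \<in> cell I"
  shows "surplus r = real d - real c"
proof -
  have r: "r \<in> X" "trace r = I" using assms by (auto simp: cell_def)
  have "N r \<inter> X = {}"
  proof (rule ccontr)
    assume "N r \<inter> X \<noteq> {}"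
    then obtain q where q: "q \<in> N r" "q \<in> X" by blast
    then show False
      using adjacent_traces_disjoint[of q r] r type_nonempty[OF trace_in_types[OF q(2)]] by blast
  qed
  then show ?thesis using card_N_Int_X[OF r(1)] r by (simp add: t_def card_I)
qed

lemma three_classes_quadratic:
  assumes T1: "three_classes L M R"
  shows "\<exists>y\<ge>0. 2 * y\<^sup>2 - (3 * real n - 6 * real d - 14 * real c) * y
    + (3 * real c - real d) * (4 * real d + 2 * real c - real n) \<le> 0"
proof -
  have T2: "three_classes M L R" and T3: "three_classes R L M"
    using three_classes_permute[OF T1] by simp_all
  note T' = three_classesD[OF T1]
  have ne: "M \<union> R \<noteq> L \<union> R" "M \<union> R \<noteq> L \<union> M" "L \<union> R \<noteq> L \<union> M" "M \<union> R \<noteq> I" "L \<union> R \<noteq> I" "L \<union> M \<noteq> I"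
    using T'(2-7) unfolding T'(1) by auto
  have cells: "cell P \<inter> cell Q = {}" if "P \<noteq> Q" for P Q
    using that by (auto simp: cell_def)
  have sum_ge: "\<nu> P * b \<le> sum surplus (cell P)" if "\<And>r. r \<in> cell P \<Longrightarrow> b \<le> surplus r" for P b
    using sum_mono[of "cell P" "\<lambda>_. b" surplus] that by simp
  let ?U = "cell (M \<union> R) \<union> cell (L \<union> R) \<union> cell (L \<union> M) \<union> cell I"
  have "sum surplus (cell (M \<union> R)) + sum surplus (cell (L \<union> R)) + sum surplus (cell (L \<union> M))
      + sum surplus (cell I) = sum surplus ?U"
    using cells ne by (simp add: sum.union_disjoint Int_Un_distrib2)
  also have "\<dots> \<le> sum surplus X"
    by (intro sum_mono2) (auto simp: cell_def surplus_nonneg)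
  also have "\<dots> \<le> 2 * excess" by (rule sum_surplus_le)
  finally have total: "\<nu> (M \<union> R) * (real d - real c - real (card L) - \<nu> L)
      + \<nu> (L \<union> R) * (real d - real c - real (card M) - \<nu> M)
      + \<nu> (L \<union> M) * (real d - real c - real (card R) - \<nu> R) + \<nu> I * (real d - real c) \<le> 2 * excess"
    using sum_ge[of "M \<union> R", OF three_classes_cells(3)[OF T1]]
      sum_ge[of "L \<union> R", OF three_classes_cells(3)[OF T2]]
      sum_ge[of "L \<union> M", OF three_classes_cells(3)[OF T3]]
      sum_ge[of I "real d - real c"] surplus_cell_I
    by fastforce
  have "finite L" "finite M" "finite R" "(L \<union> M) \<inter> R = {}"
    using finite_I T'(3,4) unfolding T'(1) by auto
  then have "card I = card L + card M + card R"
    unfolding T'(1) using T'(2) by (simp add: card_Un_disjoint)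
  then have "card L + card M + card R = c" using card_I by simp
  then have m: "real (card L) + real (card M) + real (card R) = real c" by linarith
  note deg = three_classes_degree(1)[OF T1]
    and D1 = three_classes_degree(2)[OF T1] and D2 = three_classes_degree(2)[OF T2]
    and D3 = three_classes_degree(2)[OF T3]
  show ?thesis
    using three_classes_quadratic_arith[OF deg D1 D2 D3 m three_classes_cells(1)[OF T1]
        three_classes_cells(1)[OF T2] three_classes_cells(1)[OF T3] three_classes_cells(2)[OF T1]
        three_classes_cells(2)[OF T2] three_classes_cells(2)[OF T3]]
      total[unfolded excess_def] by simp
qed

text \<open>
  The two cases are whether or not the traces of adjacent vertices of \<open>X\<close> always cover \<open>I\<close>.
\<close>
lemma dense_alternative:
  "n + 2 * c \<le> 4 * d \<or>
   (\<exists>y\<ge>0. 2 * y\<^sup>2 - (3 * real n - 6 * real d - 14 * real c) * y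
      + (3 * real c - real d) * (4 * real d + 2 * real c - real n) \<le> 0)"
proof (cases "\<forall>w\<in>X. \<forall>w'\<in>X. w' \<in> N w \<longrightarrow> trace w \<union> trace w' = I")
  case True
  then show ?thesis using complementary_types_bound by blast
next
  case False
  then obtain w w' where w: "w \<in> X" "w' \<in> X" "w' \<in> N w" "trace w \<union> trace w' \<noteq> I" by blast
  then obtain x where "x \<in> I" "x \<notin> trace w" "x \<notin> trace w'" by blast
  then obtain L M R where "three_classes L M R" using separated_edge_classes w by blast
  then show ?thesis using three_classes_quadratic by blast
qed

end

section \<open>Roots of the Krein polynomials\<close>

text \<open>
  Used with \<open>f = f_K \<rho>\<close> and \<open>f = g_K \<rho>\<close>: if \<open>f\<close> is nonnegative at \<open>a\<close>, or \<open>a\<close> lies below the interval,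
  then a sign change yields a root that is at least \<open>a\<close>.
\<close>
lemma le_Max_root:
  fixes f :: "real \<Rightarrow> real"
  assumes cont: "continuous_on {lo..hi} f" and fin: "finite {z \<in> {lo..hi}. f z = 0}"
    and "lo \<le> hi" "a \<le> hi" "0 \<le> f lo" "f hi \<le> 0" and "lo \<le> a \<Longrightarrow> 0 \<le> f a"
  shows "a \<le> Max {z \<in> {lo..hi}. f z = 0}"
proof -
  define b where "b = max a lo"
  have b: "lo \<le> b" "b \<le> hi" "a \<le> b" "0 \<le> f b" using assms by (auto simp: b_def max_def)
  have "continuous_on {b..hi} f" using cont b by (auto intro: continuous_on_subset)
  then obtain z where z: "b \<le> z" "z \<le> hi" "f z = 0"
    using IVT2'[of f hi 0 b] b assms by auto
  have "z \<le> Max {z \<in> {lo..hi}. f z = 0}" using z b fin by (intro Max_ge) auto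
  then show ?thesis using z b by linarith
qed

lemma finite_roots_f_K: "finite {z \<in> S. f_K \<rho> z = 0}"
proof -
  have "f_K \<rho> z = poly [:- 4 * \<rho>^3 + \<rho>\<^sup>2, 5 * \<rho> - 1, 3 * \<rho> - 4, 1:] z" for z
    by (simp add: f_K_def algebra_simps power2_eq_square power3_eq_cube)
  then show ?thesis
    using poly_roots_finite[of "[:- 4 * \<rho>^3 + \<rho>\<^sup>2, 5 * \<rho> - 1, 3 * \<rho> - 4, 1:]"] by simp
qed

lemma finite_roots_g_K: "finite {z \<in> S. g_K \<rho> z = 0}"
proof -
  let ?p = "[:\<rho>^3 * ((8 * sqrt 2 - 12) * \<rho> + 3 - 2 * sqrt 2),
    \<rho> * (\<rho>^2 + (15 - 10 * sqrt 2) * \<rho> + 2 * sqrt 2 - 3), \<rho> * ((6 - 4 * sqrt 2) * \<rho> + 8 * sqrt 2 - 13),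
    (4 * sqrt 2 - 8) * \<rho> + 7 - 4 * sqrt 2, 1:]"
  have "g_K \<rho> z = poly ?p z" for z
    by (simp add: g_K_def algebra_simps power2_eq_square power3_eq_cube power4_eq_xxxx)
  then show ?thesis using poly_roots_finite[of ?p] by simp
qed

lemma le_Krein:
  assumes \<rho>: "0 \<le> \<rho>" "\<rho> \<le> 1/3" and a: "a \<le> \<rho>\<^sup>2 / (1 - \<rho>)" "\<rho>\<^sup>2 \<le> a \<Longrightarrow> 0 \<le> f_K \<rho> a"
  shows "a \<le> Krein \<rho>"
  unfolding Krein_def
proof (rule le_Max_root)
  define U where "U = \<rho>\<^sup>2 / (1 - \<rho>)"
  have U: "\<rho>\<^sup>2 - U * (1 - \<rho>) = 0" using \<rho> by (simp add: U_def)
  have U0: "0 \<le> U" using \<rho> by (simp add: U_def)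
  show "continuous_on {\<rho>\<^sup>2..\<rho>\<^sup>2 / (1 - \<rho>)} (f_K \<rho>)"
    unfolding f_K_def by (intro continuous_intros)
  show "finite {z \<in> {\<rho>\<^sup>2..\<rho>\<^sup>2 / (1 - \<rho>)}. f_K \<rho> z = 0}" by (rule finite_roots_f_K)
  have "U * (1 - \<rho>) \<le> U" using U0 \<rho> by (simp add: mult_left_le)
  then show "\<rho>\<^sup>2 \<le> \<rho>\<^sup>2 / (1 - \<rho>)" using U U_def by simp
  have "f_K \<rho> (\<rho>\<^sup>2) = \<rho>^3 * (\<rho>^3 + (1 - 3 * \<rho>) * (1 - \<rho>))"
    by (simp add: f_K_def algebra_simps power2_eq_square power3_eq_cube)
  also have "0 \<le> \<dots>" using \<rho> by (intro mult_nonneg_nonneg add_nonneg_nonneg zero_le_power) auto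
  finally show "0 \<le> f_K \<rho> (\<rho>\<^sup>2)" .
  have "f_K \<rho> U = - (U * U * (\<rho> - U)) + (\<rho>\<^sup>2 - U * (1 - \<rho>)) * (1 + 4 * U - 4 * \<rho>)"
    by (simp add: f_K_def algebra_simps power2_eq_square power3_eq_cube)
  also have "\<dots> = - (U * U * (\<rho> - U))"
    unfolding U by simp
  also have "\<dots> \<le> 0"
  proof -
    have "U \<le> \<rho>" using \<rho> by (simp add: U_def divide_le_eq power2_eq_square mult_left_mono)
    then show ?thesis using U0 by simp
  qed
  finally show "f_K \<rho> (\<rho>\<^sup>2 / (1 - \<rho>)) \<le> 0" by (simp add: U_def)
qed (use a in auto)

text \<open>
  The form in which \<open>g_K\<close> arises: \<open>1 - 2 * \<rho> + a\<close> times the minimum over \<open>t0\<close> of the quadratic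
  polynomial that \<open>trace_variance_bound\<close> gives for a \<open>k\<close> depending linearly on \<open>t0\<close>; see
  \<open>g_K_nonneg\<close>.
\<close>
lemma g_K_eq:
  fixes \<rho> a :: real
  defines "e \<equiv> \<rho>\<^sup>2 - a * (1 - \<rho>)" and "s \<equiv> 2 - sqrt 2"
  shows "g_K \<rho> a = (1 - 2 * \<rho> + a) * (a^3 + a * e - e * (\<rho> - a) + 2 * s * e * (\<rho> - 2 * a)) - (a * \<rho> - s * e)\<^sup>2"
proof -
  have r: "s * s = 4 * s - 2"
    by (simp add: s_def algebra_simps)
  have "(a * \<rho> - s * e)\<^sup>2 = a\<^sup>2 * \<rho>\<^sup>2 - 2 * a * \<rho> * s * e + (s * s) * e\<^sup>2"
    by (simp add: power2_eq_square algebra_simps)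
  also have "\<dots> = a\<^sup>2 * \<rho>\<^sup>2 - 2 * a * \<rho> * s * e + (4 * s - 2) * e\<^sup>2"
    by (simp only: r)
  finally have sq: "(a * \<rho> - s * e)\<^sup>2 = a\<^sup>2 * \<rho>\<^sup>2 - 2 * a * \<rho> * s * e + (4 * s - 2) * e\<^sup>2" .
  show ?thesis
    unfolding sq unfolding g_K_def s_def e_def
    by (simp add: algebra_simps power2_eq_square power3_eq_cube power4_eq_xxxx)
qed

lemma sqrt2_bounds: "1.414213 < sqrt 2" "sqrt 2 < 1.414214"
  by (rule real_less_rsqrt real_less_lsqrt; simp add: power2_eq_square)+

lemma le_Krein_hat:
  assumes \<rho>: "0.26 \<le> \<rho>" "\<rho> \<le> 0.2725" and a: "a \<le> \<rho>\<^sup>2 / (1 - \<rho>)" "\<rho>\<^sup>2 \<le> a \<Longrightarrow> 0 \<le> g_K \<rho> a"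
  shows "a \<le> Krein_hat \<rho>"
  unfolding Krein_hat_def
proof (rule le_Max_root)
  define U where "U = \<rho>\<^sup>2 / (1 - \<rho>)"
  define s where "s = 2 - sqrt 2"
  have U: "\<rho>\<^sup>2 - U * (1 - \<rho>) = 0" using \<rho> by (simp add: U_def)
  have U0: "0 \<le> U" using \<rho> by (simp add: U_def)
  show "continuous_on {\<rho>\<^sup>2..\<rho>\<^sup>2 / (1 - \<rho>)} (g_K \<rho>)"
    unfolding g_K_def by (intro continuous_intros)
  show "finite {z \<in> {\<rho>\<^sup>2..\<rho>\<^sup>2 / (1 - \<rho>)}. g_K \<rho> z = 0}" by (rule finite_roots_g_K)
  have "U * (1 - \<rho>) \<le> U" using U0 \<rho> by (simp add: mult_left_le)
  then show "\<rho>\<^sup>2 \<le> \<rho>\<^sup>2 / (1 - \<rho>)" using U U_def by simp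
  have "g_K \<rho> (\<rho>\<^sup>2) = \<rho>^4 * ((1 - \<rho>)\<^sup>2 * (\<rho>\<^sup>2 + 2 * \<rho> - 1 + 2 * s * (1 - 2 * \<rho>)) - \<rho>\<^sup>2 * (1 - s)\<^sup>2)"
    unfolding g_K_eq s_def[symmetric]
    by (simp add: algebra_simps power2_eq_square power3_eq_cube power4_eq_xxxx)
  also have "0 \<le> \<dots>"
  proof -
    have s: "0.585 \<le> s" "s \<le> 0.586" using sqrt2_bounds by (auto simp: s_def)
    have "0.26 * 0.26 \<le> \<rho> * \<rho>" "\<rho> * \<rho> \<le> 0.2725 * 0.2725"
      using \<rho> by (intro mult_mono; simp)+
    then have r2: "0.0676 \<le> \<rho>\<^sup>2" "\<rho>\<^sup>2 \<le> 0.0743" by (simp_all add: power2_eq_square)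
    have "0.585 * 0.455 \<le> s * (1 - 2 * \<rho>)" using s \<rho> by (intro mult_mono) auto
    then have A: "0.119 \<le> \<rho>\<^sup>2 + 2 * \<rho> - 1 + 2 * s * (1 - 2 * \<rho>)" using r2 \<rho> by simp
    have B: "0.52 \<le> (1 - \<rho>)\<^sup>2" using r2 \<rho> by (simp add: power2_diff)
    have "(1 - s)\<^sup>2 \<le> 0.415\<^sup>2" using s by (intro power_mono) auto
    then have "\<rho>\<^sup>2 * (1 - s)\<^sup>2 \<le> 0.0743 * 0.415\<^sup>2" using r2 by (intro mult_mono) auto
    moreover have "0.52 * 0.119 \<le> (1 - \<rho>)\<^sup>2 * (\<rho>\<^sup>2 + 2 * \<rho> - 1 + 2 * s * (1 - 2 * \<rho>))"
      using A B by (intro mult_mono) auto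
    ultimately show ?thesis by (intro mult_nonneg_nonneg) (simp_all add: power2_eq_square)
  qed
  finally show "0 \<le> g_K \<rho> (\<rho>\<^sup>2)" .
  have "g_K \<rho> U = U * (U * (U * (1 - 2 * \<rho> + U) - \<rho>\<^sup>2))"
    unfolding g_K_eq U by (simp add: algebra_simps power2_eq_square power3_eq_cube)
  also have "U * (1 - 2 * \<rho> + U) - \<rho>\<^sup>2 = - (U * (\<rho> - U))" using U by (simp add: algebra_simps)
  also have "U * (U * - (U * (\<rho> - U))) \<le> 0"
  proof -
    have "U \<le> \<rho>" using \<rho> by (simp add: U_def divide_le_eq power2_eq_square mult_left_mono)
    then show ?thesis using U0 by simp
  qed
  finally show "g_K \<rho> (\<rho>\<^sup>2 / (1 - \<rho>)) \<le> 0" by (simp add: U_def)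
qed (use a in auto)

lemma zero_le_mult_pos:
  fixes x y :: real
  shows "0 \<le> x * y \<Longrightarrow> 0 < x \<Longrightarrow> 0 \<le> y"
  by (simp add: zero_le_mult_iff)

lemma double_le_of_codegree_bound:
  fixes a \<rho> :: real
  assumes "0 < \<rho>" "\<rho> \<le> 1/3" "a * (1 - \<rho>) \<le> \<rho>\<^sup>2"
  shows "2 * a \<le> \<rho>"
proof (rule ccontr)
  assume "\<not> ?thesis"
  then have "\<rho> / 2 * (1 - \<rho>) < a * (1 - \<rho>)" using assms by (intro mult_strict_right_mono) auto
  also have "\<dots> \<le> \<rho> * \<rho>" using assms by (simp add: power2_eq_square)
  finally have "\<rho> * (1 - \<rho>) < \<rho> * (2 * \<rho>)" by (simp add: algebra_simps)
  then show False using assms by simp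
qed

text \<open>
  With \<open>k = (a - t0)\<^sup>2 / (\<rho> - a)\<close> the hypothesis is a quadratic inequality in \<open>t0\<close>.  The polynomial
  \<open>f_K\<close> is, up to positive factors, its minimum, which is attained at \<open>t0 = a - h\<close> for the \<open>h\<close> in
  the proof; the number \<open>Q\<close> is \<open>\<rho> - a\<close> times its leading coefficient.
\<close>
lemma f_K_nonneg:
  assumes \<rho>: "0 < \<rho>" "\<rho> \<le> 1/3" and a: "\<rho>\<^sup>2 \<le> a" "a * (1 - \<rho>) \<le> \<rho>\<^sup>2"
    and variance: "\<And>t0 k. \<lbrakk>k \<le> (a - t0)\<^sup>2 / (\<rho> - a); k \<le> a / 2\<rbrakk> \<Longrightarrow>
      2 * k * (\<rho>\<^sup>2 - a * (1 - \<rho>))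
        \<le> a^3 + a * (\<rho>\<^sup>2 - a * (1 - \<rho>)) - 2 * t0 * a * \<rho> + t0\<^sup>2 * (1 - 2 * \<rho> + a)"
  shows "0 \<le> f_K \<rho> a"
proof -
  define e where "e = \<rho>\<^sup>2 - a * (1 - \<rho>)"
  define Q where "Q = \<rho> - 4 * \<rho>\<^sup>2 + a * (1 + \<rho>) - a\<^sup>2"
  define h where "h = a * (1 - 3 * \<rho> + a) * (\<rho> - a) / Q"
  have a0: "0 < a" using a(1) \<rho> by (smt (verit) zero_less_power)
  have e0: "0 \<le> e" using a by (simp add: e_def)
  have half: "2 * a \<le> \<rho>" by (rule double_le_of_codegree_bound[OF \<rho> a(2)])
  have R: "0 < \<rho> - a" and X: "0 < 1 - 3 * \<rho> + a" using half a0 \<rho> by auto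
  have "Q = (1 - 3 * \<rho> + a) * (\<rho> - a) + (2 - 3 * \<rho>) * (a - \<rho>\<^sup>2) + \<rho>\<^sup>2 * (1 - 3 * \<rho>)"
    by (simp add: Q_def algebra_simps power2_eq_square)
  moreover have "0 \<le> (2 - 3 * \<rho>) * (a - \<rho>\<^sup>2)" "0 \<le> \<rho>\<^sup>2 * (1 - 3 * \<rho>)" "0 < (1 - 3 * \<rho> + a) * (\<rho> - a)"
    using \<rho> a R X by auto
  ultimately have Q: "0 < Q" "(1 - 3 * \<rho> + a) * (\<rho> - a) \<le> Q" by linarith+
  have hQ: "h * Q = a * (1 - 3 * \<rho> + a) * (\<rho> - a)" using Q by (simp add: h_def)
  have h_le: "h \<le> a"
    using mult_left_mono[OF Q(2), of a] a0 Q(1) by (simp add: h_def divide_le_eq mult.assoc)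
  have h0: "0 \<le> h" using a0 X R Q by (simp add: h_def)
  have slope: "2 * (a * (1 - 3 * \<rho> + a)) \<le> Q"
  proof -
    \<comment> \<open>The difference is concave in \<open>a\<close>; this writes it through its values at both ends of the
      interval from \<open>\<rho>\<^sup>2\<close> to \<open>\<rho>\<^sup>2 / (1 - \<rho>)\<close>.\<close>
    have "\<rho>\<^sup>2 * (1 - \<rho>) * (Q - 2 * (a * (1 - 3 * \<rho> + a))) =
        3 * \<rho>\<^sup>2 * ((a - \<rho>\<^sup>2) * e) + (1 - \<rho>)^3 * (1 - 3 * \<rho>) * e
        + (1 - 2 * \<rho>) * ((1 - 5 * \<rho> / 2)\<^sup>2 + 3 * \<rho>\<^sup>2 / 4) * (a - \<rho>\<^sup>2)"
      by (simp add: Q_def e_def algebra_simps power2_eq_square power3_eq_cube)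
    also have "0 \<le> \<dots>"
      using \<rho> a e0 by (intro add_nonneg_nonneg mult_nonneg_nonneg zero_le_power) auto
    finally have "0 \<le> \<rho>\<^sup>2 * (1 - \<rho>) * (Q - 2 * (a * (1 - 3 * \<rho> + a)))" .
    moreover have "0 < \<rho>\<^sup>2 * (1 - \<rho>)" using \<rho> by simp
    ultimately have "0 \<le> Q - 2 * (a * (1 - 3 * \<rho> + a))" by (rule zero_le_mult_pos)
    then show ?thesis by simp
  qed
  have h_half: "h \<le> (\<rho> - a) / 2"
  proof -
    have "2 * h * Q = 2 * (a * (1 - 3 * \<rho> + a)) * (\<rho> - a)" using hQ by simp
    also have "\<dots> \<le> Q * (\<rho> - a)" using slope R by (intro mult_right_mono) auto
    finally have "2 * h * Q \<le> (\<rho> - a) * Q" by (simp add: mult.commute)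
    then show ?thesis using Q(1) by simp
  qed
  have "h * h \<le> a * ((\<rho> - a) / 2)" using h_le h_half h0 a0 by (intro mult_mono) auto
  then have "2 * (h\<^sup>2 / (\<rho> - a)) * e
      \<le> a^3 + a * e - 2 * (a - h) * a * \<rho> + (a - h)\<^sup>2 * (1 - 2 * \<rho> + a)"
    using variance[of "h\<^sup>2 / (\<rho> - a)" "a - h"] R
    by (simp add: e_def divide_le_eq power2_eq_square)
  then have "0 \<le> (\<rho> - a) * (a^3 + a * e - 2 * (a - h) * a * \<rho> + (a - h)\<^sup>2 * (1 - 2 * \<rho> + a)) - 2 * h\<^sup>2 * e"
    using R by (simp add: field_simps)
  then have "0 \<le> Q * ((\<rho> - a) * (a^3 + a * e - 2 * (a - h) * a * \<rho> + (a - h)\<^sup>2 * (1 - 2 * \<rho> + a)) - 2 * h\<^sup>2 * e)"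
    using Q(1) by simp
  also have "\<dots> = Q * (\<rho> - a) * (a^3 + a * e - 2 * a\<^sup>2 * \<rho> + a\<^sup>2 * (1 - 2 * \<rho> + a))
      - 2 * a * (1 - 3 * \<rho> + a) * (\<rho> - a) * (h * Q) + (h * Q)\<^sup>2"
    unfolding Q_def e_def by (simp add: algebra_simps power2_eq_square power3_eq_cube)
  also have "\<dots> = (\<rho> - a)\<^sup>2 * a * f_K \<rho> a"
    unfolding hQ unfolding Q_def e_def f_K_def by (simp add: algebra_simps power2_eq_square power3_eq_cube)
  finally have "0 \<le> (\<rho> - a)\<^sup>2 * a * f_K \<rho> a" .
  moreover have "0 < (\<rho> - a)\<^sup>2 * a" using R a0 by simp
  ultimately show ?thesis by (rule zero_le_mult_pos)
qed

text \<open>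
  Here \<open>k\<close> is a tangent to the parabola \<open>(a - t0)\<^sup>2 / (\<rho> - a)\<close> as a function of \<open>t0\<close>, the point of
  tangency being \<open>a - t0 = (1 - 1 / sqrt 2) * (\<rho> - a)\<close>.  The value of \<open>t0\<close> is the minimum of the
  resulting quadratic.
\<close>
lemma g_K_nonneg:
  assumes \<rho>: "0 < \<rho>" "\<rho> \<le> 1/3" and a: "\<rho>\<^sup>2 \<le> a" "a * (1 - \<rho>) \<le> \<rho>\<^sup>2"
    and variance: "\<And>t0 k. \<lbrakk>k \<le> (a - t0)\<^sup>2 / (\<rho> - a); k \<le> a / 2\<rbrakk> \<Longrightarrow>
      2 * k * (\<rho>\<^sup>2 - a * (1 - \<rho>))
        \<le> a^3 + a * (\<rho>\<^sup>2 - a * (1 - \<rho>)) - 2 * t0 * a * \<rho> + t0\<^sup>2 * (1 - 2 * \<rho> + a)"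
  shows "0 \<le> g_K \<rho> a"
proof -
  define e where "e = \<rho>\<^sup>2 - a * (1 - \<rho>)"
  define s where "s = 2 - sqrt 2"
  define Y where "Y = 1 - 2 * \<rho> + a"
  define t0 where "t0 = (a * \<rho> - s * e) / Y"
  define k where "k = s * (a - t0) - (s - 1/2) * (\<rho> - a)"
  have a0: "0 < a" using a(1) \<rho> by (smt (verit) zero_less_power)
  have e0: "0 \<le> e" using a by (simp add: e_def)
  have half: "2 * a \<le> \<rho>" by (rule double_le_of_codegree_bound[OF \<rho> a(2)])
  have R: "0 < \<rho> - a" and Y: "0 < Y" using half a0 \<rho> by (auto simp: Y_def)
  have s: "1/2 \<le> s" "s \<le> 1" "s\<^sup>2 = 4 * s - 2"
    using sqrt2_bounds by (auto simp: s_def power2_eq_square algebra_simps)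
  have t0: "t0 * Y = a * \<rho> - s * e" using Y by (simp add: t0_def)
  have "s * e \<le> e" using s e0 by (simp add: mult_left_le_one_le)
  also have "e \<le> a * \<rho>" using a by (simp add: e_def algebra_simps)
  finally have t0_nonneg: "0 \<le> t0" using Y by (simp add: t0_def)
  have "k \<le> (a - t0)\<^sup>2 / (\<rho> - a)"
  proof -
    have "k * (\<rho> - a) = (a - t0)\<^sup>2 - (a - t0 - s / 2 * (\<rho> - a))\<^sup>2 + (s\<^sup>2 / 4 - (s - 1/2)) * (\<rho> - a)\<^sup>2"
      by (simp add: k_def field_simps power2_eq_square)
    also have "s\<^sup>2 / 4 - (s - 1/2) = 0" using s(3) by simp
    finally have "k * (\<rho> - a) \<le> (a - t0)\<^sup>2" by simp
    then show ?thesis using R by (simp add: le_divide_eq)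
  qed
  moreover have "k \<le> a / 2"
  proof -
    have "s * (a - t0) \<le> s * a" using s t0_nonneg by (intro mult_left_mono) auto
    moreover have "(s - 1/2) * a \<le> (s - 1/2) * (\<rho> - a)" using s half by (intro mult_left_mono) auto
    moreover have "(s - 1/2) * a = s * a - a / 2" by (simp add: algebra_simps)
    ultimately show ?thesis unfolding k_def by linarith
  qed
  ultimately have "0 \<le> a^3 + a * e - 2 * t0 * a * \<rho> + t0\<^sup>2 * Y - 2 * k * e"
    using variance[of k t0] by (simp add: e_def Y_def)
  then have "0 \<le> Y * (a^3 + a * e - 2 * t0 * a * \<rho> + t0\<^sup>2 * Y - 2 * k * e)" using Y by simp
  also have "\<dots> = Y * (a^3 + a * e - e * (\<rho> - a) + 2 * s * e * (\<rho> - 2 * a))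
      + (t0 * Y)\<^sup>2 - 2 * (t0 * Y) * (a * \<rho> - s * e)"
    by (simp add: k_def field_simps power2_eq_square power3_eq_cube)
  also have "\<dots> = g_K \<rho> a"
    unfolding t0 g_K_eq e_def[symmetric] s_def[symmetric] Y_def[symmetric]
    by (simp add: power2_eq_square)
  finally show ?thesis .
qed

text \<open>
  The Taylor expansion at \<open>\<rho> = 27/100\<close> of the polynomial whose root is \<open>rho1\<close>.
\<close>
lemma g_K_at_line:
  "g_K (27/100 + p) ((1 - 3 * (27/100 + p)) / 2) =
    (927033/1600000000 - 89389/200000000 * sqrt 2) + (1363429/4000000 - 102407/500000 * sqrt 2) * p
    + (64977/10000 * sqrt 2 - 785769/80000) * p\<^sup>2 + (2417/50 * sqrt 2 - 31999/400) * p^3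
    + (513/16 - 29/2 * sqrt 2) * p^4"
  unfolding g_K_def by (simp add: field_simps power2_eq_square power3_eq_cube power4_eq_xxxx)

text \<open>
  On the interval in question the polynomial increases: around \<open>27/100\<close> its linear term dominates.
  So the description of \<open>rho1\<close> as the unique root there is justified.
\<close>
lemma rho1_bounds: "0.27 \<le> rho1" "rho1 \<le> 0.272"
proof -
  define G where "G p = g_K (27/100 + p) ((1 - 3 * (27/100 + p)) / 2)" for p
  define c0 c1 c2 c3 c4 where "c0 = 927033/1600000000 - 89389/200000000 * sqrt 2"
    and "c1 = 1363429/4000000 - 102407/500000 * sqrt 2"
    and "c2 = 64977/10000 * sqrt 2 - 785769/80000"
    and "c3 = 2417/50 * sqrt 2 - 31999/400" and "c4 = 513/16 - 29/2 * sqrt 2"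
  have G: "G p = c0 + c1 * p + c2 * p\<^sup>2 + c3 * p^3 + c4 * p^4" for p
    unfolding G_def c0_def c1_def c2_def c3_def c4_def by (rule g_K_at_line)
  have c: "c0 < 0" "-(3/50000) \<le> c0" "1/20 \<le> c1" "c1 \<le> 13/250" "-1 \<le> c2" "c2 \<le> 0" "-20 \<le> c3" "c3 \<le> 0" "0 \<le> c4"
    using sqrt2_bounds by (simp_all add: c0_def c1_def c2_def c3_def c4_def)
  have mono: "G p < G q" if pq: "0 \<le> p" "p < q" "q \<le> 1/500" for p q
  proof -
    have "G q - G p = (q - p) * (c1 + c2 * (q + p) + c3 * (q * q + q * p + p * p) + c4 * (q^3 + q\<^sup>2 * p + q * p\<^sup>2 + p^3))"
      unfolding G by (simp add: algebra_simps power2_eq_square power3_eq_cube power4_eq_xxxx)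
    moreover have "-(1/250) \<le> c2 * (q + p)"
      using mult_mono[of "-c2" 1 "q + p" "1/250"] c pq by simp
    moreover have "-(6/25000) \<le> c3 * (q * q + q * p + p * p)"
    proof -
      have "q * q \<le> 1/500 * 0.002" "q * p \<le> 1/500 * (1/500)" "p * p \<le> 1/500 * (1/500)"
        using pq by (intro mult_mono; simp)+
      then show ?thesis
        using mult_mono[of "-c3" 20 "q * q + q * p + p * p" "3/250000"] c pq by simp
    qed
    moreover have "0 \<le> c4 * (q^3 + q\<^sup>2 * p + q * p\<^sup>2 + p^3)" using c pq by simp
    ultimately have "0 < (q - p) * (c1 + c2 * (q + p) + c3 * (q * q + q * p + p * p) + c4 * (q^3 + q\<^sup>2 * p + q * p\<^sup>2 + p^3))"
      using c pq by (intro mult_pos_pos) linarith+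
    then show ?thesis using \<open>G q - G p = _\<close> by linarith
  qed
  have ends: "G 0 \<le> 0" "0 \<le> G (1/500)"
  proof -
    show "G 0 \<le> 0" using c by (simp add: G)
    have "c2 * (1/500)\<^sup>2 \<ge> -1 * (1/500)\<^sup>2" "c3 * (1/500)^3 \<ge> -20 * (1/500)^3" "0 \<le> c4 * (1/500)^4"
      using c by (intro mult_right_mono mult_nonneg_nonneg; simp)+
    then show "0 \<le> G (1/500)" using c unfolding G by (simp add: power2_eq_square power3_eq_cube)
  qed
  have "continuous_on {0..1/500} G" unfolding G[abs_def] by (intro continuous_intros)
  then obtain p where p: "0 \<le> p" "p \<le> 1/500" "G p = 0"
    using IVT'[of G 0 0 "1/500"] ends by auto
  have "\<exists>!\<rho>. \<rho> \<in> {0.27..0.272} \<and> g_K \<rho> ((1 - 3 * \<rho>) / 2) = 0"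
  proof (rule ex1I)
    show "0.27 + p \<in> {0.27..0.272} \<and> g_K (0.27 + p) ((1 - 3 * (0.27 + p)) / 2) = 0"
      using p by (simp add: G_def)
  next
    fix \<rho> :: real
    assume \<rho>: "\<rho> \<in> {0.27..0.272} \<and> g_K \<rho> ((1 - 3 * \<rho>) / 2) = 0"
    define q where "q = \<rho> - 0.27"
    have "0 \<le> q" "q \<le> 1/500" "G q = 0" using \<rho> by (auto simp: q_def G_def)
    then have "q = p" using mono[of p q] mono[of q p] p by linarith
    then show "\<rho> = 0.27 + p" by (simp add: q_def)
  qed
  from theI'[OF this] have "rho1 \<in> {0.27..0.272}" unfolding rho1_def by blast
  then show "0.27 \<le> rho1" "rho1 \<le> 0.272" by auto
qed

section \<open>Comparison with the seven branches\<close>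

text \<open>
  The last polynomial is the discriminant of the quadratic in \<open>y\<close>.  A nonnegative root exists only
  if the linear coefficient is negative.
\<close>
lemma discriminant_of_quadratic:
  fixes \<rho> a y :: real
  assumes y: "0 \<le> y" "2 * y\<^sup>2 - (3 - 6 * \<rho> - 14 * a) * y + (3 * a - \<rho>) * (4 * \<rho> + 2 * a - 1) \<le> 0"
    and pos: "\<rho> < 3 * a" "1 < 4 * \<rho> + 2 * a"
  shows "0 < 3 - 6 * \<rho> - 14 * a" (is "0 < ?P")
    and "0 \<le> 148 * a\<^sup>2 + 88 * a * \<rho> + 68 * \<rho>\<^sup>2 - 60 * a - 44 * \<rho> + 9"
proof -
  have K: "0 < (3 * a - \<rho>) * (4 * \<rho> + 2 * a - 1)" using pos by simp
  have "0 < ?P * y" using y(2) K zero_le_power2[of y] by linarith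
  then show "0 < ?P" using y(1) by (simp add: zero_less_mult_iff)
  have "0 \<le> (4 * y - ?P)\<^sup>2 + 8 * (- (2 * y\<^sup>2 - ?P * y + (3 * a - \<rho>) * (4 * \<rho> + 2 * a - 1)))"
    using y(2) by (intro add_nonneg_nonneg) auto
  also have "\<dots> = 148 * a\<^sup>2 + 88 * a * \<rho> + 68 * \<rho>\<^sup>2 - 60 * a - 44 * \<rho> + 9"
    by (simp add: algebra_simps power2_eq_square)
  finally show "0 \<le> 148 * a\<^sup>2 + 88 * a * \<rho> + 68 * \<rho>\<^sup>2 - 60 * a - 44 * \<rho> + 9" .
qed

text \<open>
  \<open>Improved \<rho>\<close> is the smaller root of the discriminant as a polynomial in \<open>a\<close>, and the first
  hypothesis says that \<open>a\<close> is to the left of the midpoint of the two roots.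
\<close>
lemma le_Improved:
  assumes "0 \<le> 15 - 22 * \<rho> - 74 * a"
    and "0 \<le> 148 * a\<^sup>2 + 88 * a * \<rho> + 68 * \<rho>\<^sup>2 - 60 * a - 44 * \<rho> + 9"
  shows "a \<le> Improved \<rho>"
proof -
  have "((15 - 22 * \<rho> - 74 * a) / 2)\<^sup>2 = 242 * \<rho> - 27 - 508 * \<rho>\<^sup>2
      + 37 / 4 * (148 * a\<^sup>2 + 88 * a * \<rho> + 68 * \<rho>\<^sup>2 - 60 * a - 44 * \<rho> + 9)"
    by (simp add: field_simps power2_eq_square)
  then have "sqrt (242 * \<rho> - 27 - 508 * \<rho>\<^sup>2) \<le> (15 - 22 * \<rho> - 74 * a) / 2"
    using assms by (intro real_le_lsqrt) auto
  then show ?thesis by (simp add: Improved_def)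
qed

text \<open>
  On the middle branches, assume \<open>a > a0 \<rho>\<close>.  Then \<open>a > \<rho> / 3\<close> and \<open>2 * a + 3 * \<rho> > 1\<close>, so
  \<open>dense\<close> applies, and its first alternative \<open>a \<le> 2 * \<rho> - 1 / 2\<close> fails.  The second one forces
  \<open>14 * a < 3 - 6 * \<rho>\<close>, which is impossible for \<open>\<rho> > 9 / 32\<close>, and a nonnegative discriminant.
  At \<open>a = (1 - 3 * \<rho>) / 2\<close> the discriminant changes sign at \<open>rho2\<close>, and at \<open>a = \<rho> / 3\<close> it is a
  square that vanishes at \<open>9 / 32\<close>.
\<close>
lemma le_a0:
  fixes \<rho> a :: real
  assumes \<rho>: "0 \<le> \<rho>" "\<rho> \<le> 1/3" and U: "a * (1 - \<rho>) \<le> \<rho>\<^sup>2"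
    and fK: "\<rho>\<^sup>2 \<le> a \<Longrightarrow> 0 \<le> f_K \<rho> a"
    and gK: "\<lbrakk>0 < \<rho>; \<rho>\<^sup>2 \<le> a\<rbrakk> \<Longrightarrow> 0 \<le> g_K \<rho> a"
    and pentagon: "5 * a \<le> 2 * \<rho>"
    and dense: "\<lbrakk>\<rho> < 3 * a; 1 < 3 * \<rho> + 2 * a\<rbrakk> \<Longrightarrow> 1 + 2 * a \<le> 4 * \<rho> \<or>
      (\<exists>y\<ge>0. 2 * y\<^sup>2 - (3 - 6 * \<rho> - 14 * a) * y + (3 * a - \<rho>) * (4 * \<rho> + 2 * a - 1) \<le> 0)"
  shows "a \<le> a0 \<rho>"
proof -
  let ?q = "\<lambda>a. 148 * a\<^sup>2 + 88 * a * \<rho> + 68 * \<rho>\<^sup>2 - 60 * a - 44 * \<rho> + 9"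
  have U': "a \<le> \<rho>\<^sup>2 / (1 - \<rho>)" using U \<rho> by (simp add: le_divide_eq)
  have rho0: "0.26 \<le> rho0" using sqrt2_bounds by (simp add: rho0_def)
  have q_line: "?q ((1 - 3 * \<rho>) / 2) = ((269 * \<rho> - 66)\<^sup>2 - 52) / 269"
    by (simp add: field_simps power2_eq_square)
  have obstruction: "0 < 3 - 6 * \<rho> - 14 * a \<and> 0 \<le> ?q a"
    if h: "\<rho> < 3 * a" "1 < 3 * \<rho> + 2 * a" "4 * \<rho> < 1 + 2 * a"
  proof -
    obtain y where "0 \<le> y" "2 * y\<^sup>2 - (3 - 6 * \<rho> - 14 * a) * y + (3 * a - \<rho>) * (4 * \<rho> + 2 * a - 1) \<le> 0"
      using dense h by force
    then show ?thesis using discriminant_of_quadratic[of y \<rho> a] h \<rho> by auto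
  qed
  consider "\<rho> \<le> rho0" | "rho0 < \<rho>" "\<rho> \<le> rho1" | "rho0 < \<rho>" "rho1 < \<rho>" "\<rho> \<le> rho2"
    | "rho0 < \<rho>" "rho1 < \<rho>" "rho2 < \<rho>" "\<rho> \<le> 9/32"
    | "rho0 < \<rho>" "rho1 < \<rho>" "rho2 < \<rho>" "9/32 < \<rho>" "\<rho> \<le> 3/10"
    | "rho0 < \<rho>" "rho1 < \<rho>" "rho2 < \<rho>" "3/10 < \<rho>" "\<rho> \<le> 5/16"
    | "rho0 < \<rho>" "rho1 < \<rho>" "rho2 < \<rho>" "5/16 < \<rho>"
    by linarith
  then show ?thesis
  proof cases
    case 1
    then have "a0 \<rho> = Krein \<rho>" by (simp add: a0_def)
    then show ?thesis using le_Krein[OF \<rho> U' fK] by simp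
  next
    case 2
    then have "a0 \<rho> = Krein_hat \<rho>" by (simp add: a0_def)
    then show ?thesis using le_Krein_hat[of \<rho> a] 2 rho0 rho1_bounds U' gK by simp
  next
    case 3
    then have a0: "a0 \<rho> = (1 - 3 * \<rho>) / 2" by (simp add: a0_def)
    have r: "27/100 < \<rho>" using 3 rho1_bounds by simp
    have s13: "sqrt 13 < 73/20" by (rule real_less_lsqrt; simp add: power2_eq_square)
    have "\<rho> * 269 \<le> 66 + 2 * sqrt 13" using 3 by (simp add: rho2_def pos_le_divide_eq)
    then have le: "269 * \<rho> - 66 \<le> 2 * sqrt 13" by linarith
    then have r': "\<rho> < 3/11" using s13 by linarith
    have "(269 * \<rho> - 66)\<^sup>2 \<le> (2 * sqrt 13)\<^sup>2" using le r by (intro power_mono; linarith)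
    also have "\<dots> = 52" by (simp add: power_mult_distrib)
    finally have "(269 * \<rho> - 66)\<^sup>2 - 52 \<le> 0" by simp
    then have q0: "?q ((1 - 3 * \<rho>) / 2) \<le> 0" unfolding q_line by simp
    show ?thesis
    proof (rule ccontr)
      assume "\<not> ?thesis"
      then have gt: "(1 - 3 * \<rho>) / 2 < a" using a0 by simp
      have "1 < 3 * \<rho> + 2 * a" using gt by simp
      moreover from this r' have "\<rho> < 3 * a" by simp
      moreover from calculation r' have "4 * \<rho> < 1 + 2 * a" by simp
      ultimately have ob: "0 < 3 - 6 * \<rho> - 14 * a" "0 \<le> ?q a" using obstruction by blast+
      have "?q a - ?q ((1 - 3 * \<rho>) / 2)
          = (a - (1 - 3 * \<rho>) / 2) * (148 * (a + (1 - 3 * \<rho>) / 2) + 88 * \<rho> - 60)"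
        by (simp add: field_simps power2_eq_square)
      also have "\<dots> < 0"
      proof (rule mult_pos_neg)
        show "0 < a - (1 - 3 * \<rho>) / 2" using gt by simp
        have "148 * a + 14 - 134 * \<rho> < 0" using ob(1) r by linarith
        then show "148 * (a + (1 - 3 * \<rho>) / 2) + 88 * \<rho> - 60 < 0" by (simp add: field_simps)
      qed
      finally show False using ob(2) q0 by linarith
    qed
  next
    case 4
    then have a0: "a0 \<rho> = Improved \<rho>" by (simp add: a0_def)
    have r: "27/100 < \<rho>" "\<rho> \<le> 9/32" using 4 rho1_bounds by auto
    have "66 + 2 * sqrt 13 \<le> \<rho> * 269" using 4 by (simp add: rho2_def pos_divide_le_eq)
    then have "(2 * sqrt 13)\<^sup>2 \<le> (269 * \<rho> - 66)\<^sup>2" by (intro power_mono) auto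
    then have "0 \<le> (269 * \<rho> - 66)\<^sup>2 - 52" by (simp add: power_mult_distrib)
    then have "0 \<le> ?q ((1 - 3 * \<rho>) / 2)" unfolding q_line by simp
    moreover have "0 \<le> 15 - 22 * \<rho> - 74 * ((1 - 3 * \<rho>) / 2)" using r by simp
    ultimately have "(1 - 3 * \<rho>) / 2 \<le> Improved \<rho>" by (intro le_Improved)
    then have I1: "1 - 3 * \<rho> \<le> 2 * Improved \<rho>" by simp
    have "?q (\<rho> / 3) = (3 - 32 * \<rho> / 3)\<^sup>2" by (simp add: field_simps power2_eq_square)
    then have "0 \<le> ?q (\<rho> / 3)" by simp
    moreover have "0 \<le> 15 - 22 * \<rho> - 74 * (\<rho> / 3)" using r by simp
    ultimately have I2: "\<rho> / 3 \<le> Improved \<rho>" by (intro le_Improved)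
    show ?thesis
    proof (rule ccontr)
      assume "\<not> ?thesis"
      then have gt: "Improved \<rho> < a" using a0 by simp
      have "\<rho> < 3 * a" "1 < 3 * \<rho> + 2 * a" "4 * \<rho> < 1 + 2 * a" using gt I1 I2 r by linarith+
      then have ob: "0 < 3 - 6 * \<rho> - 14 * a" "0 \<le> ?q a" using obstruction by blast+
      have "0 \<le> 15 - 22 * \<rho> - 74 * a" using ob(1) r by linarith
      then have "a \<le> Improved \<rho>" using ob(2) by (rule le_Improved)
      then show False using gt by simp
    qed
  next
    case 5
    then have a0: "a0 \<rho> = \<rho> / 3" by (simp add: a0_def)
    show ?thesis
    proof (rule ccontr)
      assume "\<not> ?thesis"
      then have "\<rho> / 3 < a" using a0 by simp
      then have "\<rho> < 3 * a" "1 < 3 * \<rho> + 2 * a" "4 * \<rho> < 1 + 2 * a" "3 - 6 * \<rho> - 14 * a < 0"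
        using 5 by linarith+
      then show False using obstruction by auto
    qed
  next
    case 6
    then have a0: "a0 \<rho> = 2 * \<rho> - 1 / 2" by (simp add: a0_def)
    show ?thesis
    proof (rule ccontr)
      assume "\<not> ?thesis"
      then have "2 * \<rho> - 1 / 2 < a" using a0 by simp
      then have "\<rho> < 3 * a" "1 < 3 * \<rho> + 2 * a" "4 * \<rho> < 1 + 2 * a" "3 - 6 * \<rho> - 14 * a < 0"
        using 6 by linarith+
      then show False using obstruction by auto
    qed
  next
    case 7
    then have "a0 \<rho> = 2/5 * \<rho>" by (simp add: a0_def)
    then show ?thesis using pentagon by simp
  qed
qed

text \<open>
  All counting results are homogeneous in \<open>n, d, c\<close>; dividing by a power of \<open>n\<close> turns them into the
  hypotheses of \<open>le_a0\<close>.
\<close>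
lemma (in codegree_graph) codegree_le_a0:
  assumes tight: "u \<in> V" "v \<in> V" "v \<notin> N u" "card (N u \<inter> N v) = c" and d: "3 * d \<le> n"
  shows "real c / real n \<le> a0 (real d / real n)"
proof -
  interpret tight_pair V N d c u v by unfold_locales (use tight in auto)
  have n: "0 < real n" using finite_V u_in by (auto simp: card_gt_0_iff)
  note V_nonempty [simp] finite_V [simp]
  define \<rho> a where "\<rho> = real d / real n" and "a = real c / real n"
  have d_eq: "real d = \<rho> * real n" and c_eq: "real c = a * real n"
    using n by (simp_all add: \<rho>_def a_def)
  have \<rho>: "0 \<le> \<rho>" "\<rho> \<le> 1/3" using d n by (simp_all add: \<rho>_def field_simps)
  have a0: "0 \<le> a" by (simp add: a_def)
  have excess_eq: "excess = real n ^ 2 * (\<rho>\<^sup>2 - a * (1 - \<rho>))"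
    by (simp add: excess_def d_eq c_eq algebra_simps power2_eq_square)
  have U: "a * (1 - \<rho>) \<le> \<rho>\<^sup>2"
    using excess_nonneg n by (simp add: excess_eq zero_le_mult_iff)
  have variance: "2 * k * (\<rho>\<^sup>2 - a * (1 - \<rho>))
      \<le> a^3 + a * (\<rho>\<^sup>2 - a * (1 - \<rho>)) - 2 * t0 * a * \<rho> + t0\<^sup>2 * (1 - 2 * \<rho> + a)"
    if pos: "0 < \<rho>" and k: "k \<le> (a - t0)\<^sup>2 / (\<rho> - a)" "k \<le> a / 2" for t0 k
  proof -
    have "2 * a \<le> \<rho>" using double_le_of_codegree_bound pos \<rho> U by blast
    then have lt: "a < \<rho>" using pos a0 by simp
    then have "real c < real d" using n by (simp add: c_eq d_eq)
    then have cd: "c < d" by simp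
    have "(real c - t0 * real n)\<^sup>2 / (real d - real c) = (a - t0)\<^sup>2 / (\<rho> - a) * real n"
      using n lt by (simp add: c_eq d_eq field_simps power2_eq_square)
    moreover have "k * real n \<le> (a - t0)\<^sup>2 / (\<rho> - a) * real n"
      using k(1) n by (intro mult_right_mono) auto
    ultimately have "k * real n \<le> (real c - t0 * real n)\<^sup>2 / (real d - real c)" by simp
    moreover have "k * real n \<le> real c / 2" using k n by (simp add: c_eq)
    ultimately have "2 * (k * real n) * excess \<le> (real c)^3 + real c * excess
        - 2 * (t0 * real n) * real c * real d + (t0 * real n)\<^sup>2 * (real n - 2 * real d + real c)"
      by (rule trace_variance_bound[OF cd])
    then have "real n ^ 3 * (2 * k * (\<rho>\<^sup>2 - a * (1 - \<rho>)))
        \<le> real n ^ 3 * (a^3 + a * (\<rho>\<^sup>2 - a * (1 - \<rho>)) - 2 * t0 * a * \<rho> + t0\<^sup>2 * (1 - 2 * \<rho> + a))"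
      by (simp add: excess_eq c_eq d_eq algebra_simps power2_eq_square power3_eq_cube)
    then show ?thesis using n by simp
  qed
  have "a \<le> a0 \<rho>"
  proof (rule le_a0[OF \<rho> U])
    assume sq: "\<rho>\<^sup>2 \<le> a"
    show "0 \<le> f_K \<rho> a"
    proof (cases "\<rho> = 0")
      case True
      then have "a = 0" using U a0 by simp
      then show ?thesis using True by (simp add: f_K_def)
    next
      case False
      then show ?thesis using f_K_nonneg \<rho> sq U variance by simp
    qed
  next
    assume "0 < \<rho>" "\<rho>\<^sup>2 \<le> a"
    then show "0 \<le> g_K \<rho> a" using g_K_nonneg \<rho> U variance by simp
  next
    show "5 * a \<le> 2 * \<rho>"
      using codegree_le_two_fifths[OF V_nonempty d] n by (simp add: a_def \<rho>_def field_simps)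
  next
    assume "\<rho> < 3 * a" "1 < 3 * \<rho> + 2 * a"
    then have "real d < 3 * real c" "real n < 3 * real d + 2 * real c"
      using n by (simp_all add: a_def \<rho>_def field_simps)
    then have "d < 3 * c" "n < 3 * d + 2 * c" by linarith+
    then interpret dense_tight_pair V N d c u v by unfold_locales
    from dense_alternative
    show "1 + 2 * a \<le> 4 * \<rho> \<or>
      (\<exists>y\<ge>0. 2 * y\<^sup>2 - (3 - 6 * \<rho> - 14 * a) * y + (3 * a - \<rho>) * (4 * \<rho> + 2 * a - 1) \<le> 0)"
    proof
      assume "n + 2 * c \<le> 4 * d"
      then have "real n + 2 * real c \<le> 4 * real d" by linarith
      then have "(real n + 2 * real c) / real n \<le> 4 * real d / real n"
        using n by (intro divide_right_mono) auto
      moreover have "(real n + 2 * real c) / real n = 1 + 2 * a" using n by (simp add: a_def add_divide_distrib)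
      ultimately have "1 + 2 * a \<le> 4 * \<rho>" by (simp add: \<rho>_def)
      then show ?thesis by blast
    next
      assume "\<exists>W\<ge>0. 2 * W\<^sup>2 - (3 * real n - 6 * real d - 14 * real c) * W
        + (3 * real c - real d) * (4 * real d + 2 * real c - real n) \<le> 0"
      then obtain W where W: "0 \<le> W" "2 * W\<^sup>2 - (3 * real n - 6 * real d - 14 * real c) * W
        + (3 * real c - real d) * (4 * real d + 2 * real c - real n) \<le> 0" by blast
      define y where "y = W / real n"
      have W_eq: "W = y * real n" using n by (simp add: y_def)
      have "real n ^ 2 * (2 * y\<^sup>2 - (3 - 6 * \<rho> - 14 * a) * y + (3 * a - \<rho>) * (4 * \<rho> + 2 * a - 1)) \<le> 0"
        using W(2) by (simp add: W_eq c_eq d_eq algebra_simps power2_eq_square)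
      then have "2 * y\<^sup>2 - (3 - 6 * \<rho> - 14 * a) * y + (3 * a - \<rho>) * (4 * \<rho> + 2 * a - 1) \<le> 0"
        using n by (simp add: mult_le_0_iff)
      moreover have "0 \<le> y" using W(1) n by (simp add: y_def)
      ultimately show ?thesis by blast
    qed
  qed
  then show ?thesis by (simp add: a_def \<rho>_def)
qed

section \<open>From counting to graph densities\<close>

lemma card_parcs_eq_twice_edges:
  assumes "pair_graph G"
  shows "card (parcs G) = 2 * card (graph_edges G)"
proof -
  interpret pair_graph G by fact
  have sym: "(v, u) \<in> parcs G" if "(u, v) \<in> parcs G" for u v
    using pair_sym_arcs that by (auto simp: symmetric_def dest: symD)
  have loop: "u \<noteq> v" if "(u, v) \<in> parcs G" for u v
    using pair_no_loops[OF that] by simp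
  let ?F = "\<lambda>e. {p \<in> parcs G. {fst p, snd p} = e}"
  have edges: "graph_edges G = (\<lambda>p. {fst p, snd p}) ` parcs G"
    by (force simp: graph_edges_def)
  have fib: "card (?F e) = 2" if e: "e \<in> graph_edges G" for e
  proof -
    obtain u v where uv: "e = {u, v}" "(u, v) \<in> parcs G" using e by (auto simp: graph_edges_def)
    then have "?F e = {(u, v), (v, u)}" using sym by (auto simp: doubleton_eq_iff)
    then show ?thesis using loop[OF uv(2)] by simp
  qed
  have "parcs G = (\<Union>e\<in>graph_edges G. ?F e)" by (auto simp: edges)
  then have "card (parcs G) = card (\<Union>e\<in>graph_edges G. ?F e)" by simp
  also have "\<dots> = (\<Sum>e\<in>graph_edges G. card (?F e))"
    using pair_finite_arcs by (intro card_UN_disjoint) (auto simp: edges)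
  finally show ?thesis using fib by simp
qed

lemma edge_density_eq:
  assumes G: "pair_graph G" and reg: "\<And>v. v \<in> pverts G \<Longrightarrow> card (nbhd G v) = d"
  shows "edge_density G = real d / real (card (pverts G))"
proof -
  interpret pair_graph G by (rule G)
  have "parcs G = Sigma (pverts G) (nbhd G)"
    using in_arcsD1 by (auto simp: nbhd_def)
  moreover have "finite (nbhd G v)" for v
    using in_arcsD2 by (intro finite_subset[OF _ pair_finite_verts]) (auto simp: nbhd_def)
  ultimately have "card (parcs G) = card (pverts G) * d"
    using reg pair_finite_verts by (simp add: card_SigmaI)
  then have "2 * card (graph_edges G) = card (pverts G) * d"
    by (simp add: card_parcs_eq_twice_edges[OF G])
  from arg_cong[OF this, of real]
  have "2 * real (card (graph_edges G)) = real (card (pverts G)) * real d" by simp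
  then show ?thesis by (simp add: edge_density_def power2_eq_square)
qed

lemma min_codegree_le_a0:
  assumes "triangle_free G" and G: "rho_regular \<rho> G" and \<rho>: "\<rho> \<le> 1/3"
  shows "min_codegree G \<le> a0 \<rho>"
proof -
  interpret pair_graph G using G by (simp add: rho_regular_def)
  let ?V = "pverts G" and ?N = "nbhd G"
  obtain d where d: "\<And>v. v \<in> ?V \<Longrightarrow> card (?N v) = d"
    using G by (auto simp: rho_regular_def regular_graph_def)
  have dens: "\<rho> = real d / real (card ?V)"
    using edge_density_eq[OF pair_graph_axioms d] G by (simp add: rho_regular_def)
  have ne: "?V \<noteq> {}" using G by (simp add: rho_regular_def)
  have sym: "(v, w) \<in> parcs G \<longleftrightarrow> (w, v) \<in> parcs G" for v w
    using pair_sym_arcs by (auto simp: symmetric_def dest: symD)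
  define S where "S = {(u, v). u \<in> ?V \<and> v \<in> ?V \<and> (u, v) \<notin> parcs G}"
  define cd where "cd = (\<lambda>(u, v). card (?N u \<inter> ?N v))"
  define c where "c = Min (cd ` S)"
  have fin: "finite S"
    using pair_finite_verts by (auto simp: S_def intro: finite_subset[of _ "?V \<times> ?V"])
  obtain x where "x \<in> ?V" using ne by blast
  then have "(x, x) \<in> S" using pair_no_loops[of "(x, x)"] by (auto simp: S_def)
  then have "c \<in> cd ` S" unfolding c_def using fin by (intro Min_in) auto
  then obtain u v where uv: "(u, v) \<in> S" "card (?N u \<inter> ?N v) = c" by (auto simp: cd_def)
  have c_le: "c \<le> card (?N p \<inter> ?N q)" if "(p, q) \<in> S" for p q
  proof -
    have "cd (p, q) \<in> cd ` S" using that by (rule imageI)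
    then have "c \<le> cd (p, q)" unfolding c_def using fin by (intro Min_le) auto
    then show ?thesis by (simp add: cd_def)
  qed
  interpret cg: codegree_graph ?V ?N d c
  proof
    show "?N p \<subseteq> ?V" for p using in_arcsD2 by (auto simp: nbhd_def)
    show "(w \<in> ?N p) = (p \<in> ?N w)" for w p using sym by (simp add: nbhd_def)
    show "?N p \<inter> ?N w = {}" if "w \<in> ?N p" for w p
      using that \<open>triangle_free G\<close> sym unfolding triangle_free_def nbhd_def by blast
    show "c \<le> card (?N p \<inter> ?N q)" if "p \<in> ?V" "q \<in> ?V" "q \<notin> ?N p" for p q
      using that by (intro c_le) (auto simp: S_def nbhd_def)
  qed (use d pair_finite_verts in auto)
  have "{real (card (?N p \<inter> ?N q)) / real (card ?V) | p q.
            p \<in> ?V \<and> q \<in> ?V \<and> (p, q) \<notin> parcs G} = (\<lambda>z. real (cd z) / real (card ?V)) ` S"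
    by (force simp: S_def cd_def)
  then have "min_codegree G \<le> real c / real (card ?V)"
  proof -
    have "real c / real (card ?V) \<in> (\<lambda>z. real (cd z) / real (card ?V)) ` S"
      using uv by (intro image_eqI[of _ _ "(u, v)"]) (auto simp: cd_def)
    then show ?thesis
      unfolding min_codegree_def \<open>_ = (\<lambda>z. real (cd z) / real (card ?V)) ` S\<close>
      using fin by (intro Min_le) auto
  qed
  also have "\<dots> \<le> a0 (real d / real (card ?V))"
  proof (rule cg.codegree_le_a0)
    show "u \<in> ?V" "v \<in> ?V" "v \<notin> ?N u" "card (?N u \<inter> ?N v) = c"
      using uv by (auto simp: S_def nbhd_def)
    have "0 < card ?V" using ne pair_finite_verts by (simp add: card_gt_0_iff)
    then show "3 * d \<le> card ?V"
      using \<rho> unfolding dens by (simp add: field_simps flip: of_nat_le_iff)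
  qed
  finally show ?thesis using dens by simp
qed

text \<open>
  A \<open>k\<close>-regular bipartite graph with parts \<open>{..<q}\<close> and \<open>{q..<2 * q}\<close>.  Shifting the second part by \<open>q\<close>
  does not change residues modulo \<open>q\<close>, so one symmetric condition serves for both parts.
\<close>
definition bipartite_circulant :: "nat \<Rightarrow> nat \<Rightarrow> nat pair_pre_digraph" where
  "bipartite_circulant q k = \<lparr> pverts = {..<2 * q},
     parcs = {(x, y). x < 2 * q \<and> y < 2 * q \<and> (x < q \<longleftrightarrow> \<not> y < q) \<and> (x + y) mod q < k} \<rparr>"

lemma bipartite_circulant_pair_graph: "pair_graph (bipartite_circulant q k)"
proof
  let ?G = "bipartite_circulant q k"
  have "parcs ?G \<subseteq> {..<2 * q} \<times> {..<2 * q}" by (auto simp: bipartite_circulant_def)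
  then show "finite (parcs ?G)" by (rule finite_subset) auto
  show "symmetric (with_proj ?G)"
    by (auto simp: symmetric_def bipartite_circulant_def add.commute intro!: symI)
qed (auto simp: bipartite_circulant_def)

lemma bipartite_circulant_triangle_free: "triangle_free (bipartite_circulant q k)"
  by (auto simp: triangle_free_def bipartite_circulant_def)

text \<open>
  As \<open>y\<close> runs through the opposite part, \<open>(x + y) mod q\<close> takes every residue exactly once.
\<close>
lemma bipartite_circulant_degree:
  assumes "k \<le> q" "x < 2 * q"
  shows "card (nbhd (bipartite_circulant q k) x) = k"
proof -
  define lo where "lo = (if x < q then q else 0)"
  have q: "0 < q" using assms by simp
  have nb: "nbhd (bipartite_circulant q k) x = {y \<in> {lo..<lo + q}. (x + y) mod q < k}"
    using assms by (auto simp: nbhd_def bipartite_circulant_def lo_def)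
  have inj: "inj_on (\<lambda>y. (x + y) mod q) {lo..<lo + q}"
  proof (rule inj_onI)
    fix y z assume yz: "y \<in> {lo..<lo + q}" "z \<in> {lo..<lo + q}" "(x + y) mod q = (x + z) mod q"
    have *: "y = z" if "y \<le> z" "y \<in> {lo..<lo + q}" "z \<in> {lo..<lo + q}" "(x + y) mod q = (x + z) mod q" for y z
    proof -
      have "q dvd (x + z) - (x + y)" using that by (intro mod_eq_dvd_iff_nat[THEN iffD1]) auto
      then have "q dvd z - y" by simp
      moreover have "z - y < q" using that by auto
      ultimately show ?thesis using that by (auto dest: dvd_imp_le)
    qed
    show "y = z"
      using *[OF _ yz] *[OF _ yz(2,1) yz(3)[symmetric]] nat_le_linear[of y z] by auto
  qed
  have onto: "(\<lambda>y. (x + y) mod q) ` {lo..<lo + q} = {..<q}"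
  proof (rule card_subset_eq)
    show "(\<lambda>y. (x + y) mod q) ` {lo..<lo + q} \<subseteq> {..<q}" using q by auto
    show "card ((\<lambda>y. (x + y) mod q) ` {lo..<lo + q}) = card {..<q}" by (simp add: card_image[OF inj])
  qed simp
  have "bij_betw (\<lambda>y. (x + y) mod q) {y \<in> {lo..<lo + q}. (x + y) mod q < k} {..<k}"
  proof (rule bij_betw_imageI)
    show "inj_on (\<lambda>y. (x + y) mod q) {y \<in> {lo..<lo + q}. (x + y) mod q < k}"
      by (rule inj_on_subset[OF inj]) blast
    have "j \<in> (\<lambda>y. (x + y) mod q) ` {y \<in> {lo..<lo + q}. (x + y) mod q < k}" if j: "j < k" for j
    proof -
      have "j \<in> (\<lambda>y. (x + y) mod q) ` {lo..<lo + q}" using j assms(1) unfolding onto by simp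
      then obtain y where "y \<in> {lo..<lo + q}" "j = (x + y) mod q" by blast
      then show ?thesis using j by blast
    qed
    then show "(\<lambda>y. (x + y) mod q) ` {y \<in> {lo..<lo + q}. (x + y) mod q < k} = {..<k}" by auto
  qed
  then show ?thesis using bij_betw_same_card by (fastforce simp: nb)
qed

text \<open>
  For \<open>\<rho> = p / q\<close> take degree \<open>2 * p\<close> on \<open>2 * q\<close> vertices.  The supremum in \<open>a_max\<close> is meaningful only
  because such a graph exists.
\<close>
lemma exists_triangle_free_rho_regular:
  assumes "\<rho> \<in> \<rat>" "0 \<le> \<rho>" "\<rho> \<le> 1/2"
  obtains G :: "nat pair_pre_digraph" where "triangle_free G" "rho_regular \<rho> G"
proof -
  obtain p q :: nat where pq: "q \<noteq> 0" "\<bar>\<rho>\<bar> = real p / real q"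
    using Rats_abs_nat_div_natE[OF assms(1)] by metis
  then have \<rho>: "\<rho> = real p / real q" using assms by simp
  let ?G = "bipartite_circulant q (2 * p)"
  have "real (2 * p) \<le> real q" using assms(3) pq unfolding \<rho> by (simp add: field_simps)
  then have le: "2 * p \<le> q" by linarith
  have V: "pverts ?G = {..<2 * q}" by (simp add: bipartite_circulant_def)
  have deg: "card (nbhd ?G v) = 2 * p" if "v \<in> pverts ?G" for v
    using bipartite_circulant_degree[OF le] that V by simp
  have "rho_regular \<rho> ?G"
    unfolding rho_regular_def regular_graph_def
    using deg edge_density_eq[OF bipartite_circulant_pair_graph deg] pq V
    by (auto simp: bipartite_circulant_pair_graph \<rho> lessThan_empty_iff)
  then show ?thesis using that bipartite_circulant_triangle_free by blast
qed

theorem theorem3p1: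
  fixes \<rho> :: real
  assumes "\<rho> \<in> \<rat>" and "0 \<le> \<rho>" and "\<rho> \<le> 1/3"
  shows "a_max \<rho> \<le> a0 \<rho>"
proof -
  obtain H :: "nat pair_pre_digraph" where "triangle_free H" "rho_regular \<rho> H"
    using exists_triangle_free_rho_regular[of \<rho>] assms by auto
  then show ?thesis
    unfolding a_max_def using assms(3) by (intro cSup_least) (auto intro: min_codegree_le_a0)
qed

end
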